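(* For every integer $d \ge 2$, $p_d \le \frac{1}{3}$, where $p_d := \inf\{p\in[0,1] : \mathrm{FM}(d,p) \text{ is recurrent}\}$ is the critical drift of the one-per-site frog model $\mathrm{FM}(d,p)$ on the rooted $d$-ary tree.
   Context: Let $\mathbb{T}_d$ be the infinite rooted $d$-ary tree: every vertex has $d$ child vertices, and every vertex other than the root $\varnothing$ has one parent vertex. The (one-per-site) frog model $\mathrm{FM}(d,p)$ with drift parameter $p\in[0,1]$ is the following discrete-time process. At time $t=0$ there is exactly one sleeping (inactive) frog at each vertex other than the root, and one active frog at the root. Active frogs perform independent random walks: from a vertex other than the root, a frog jumps to the parent with probability $p$ and to each of the $d$ children with probability $(1-p)/d$; from the root, a frog jumps to each of the $d$ children with probability $1/d$. Whenever an active frog visits a vertex with a sleeping frog, the sleeping frog wakes up and begins its own independent random walk following the same rules. Let $V_{d,p}$ be the total number of visits to the root in $\mathrm{FM}(d,p)$. It is known that $P(V_{d,p}=\infty)\in\{0,1\}$. The model $\mathrm{FM}(d,p)$ is called recurrent if $P(V_{d,p}=\infty)=1$ and transient if $P(V_{d,p}=\infty)=0$. *)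

theory Defs
  imports "HOL-Probability.Probability"
begin

text \<open>
  The rooted \<open>d\<close>-ary tree: a vertex is the list of the child indices on the path
  joining it to the root, most recent index first. The root is \<open>[]\<close>, the children of \<open>v\<close> are
  \<open>i # v\<close> for \<open>i < d\<close>, and the parent of \<open>v \<noteq> []\<close> is \<open>tl v\<close>.
\<close>

type_synonym vertex = "nat list"

definition vertices :: "nat \<Rightarrow> vertex set" where
  "vertices d = lists {..<d}"

text \<open>
  The random walks are driven by i.i.d. marks \<open>(up, i)\<close> with independent components:
  \<open>up\<close> holds with probability \<open>p\<close>, and \<open>i\<close> is uniform on \<open>{..<d}\<close>. Away from the root the walk
  moves to the parent if \<open>up\<close> holds and to the \<open>i\<close>-th child otherwise; at the root \<open>up\<close> is ignored.
  The lemmas \<open>move_root\<close>, \<open>move_parent\<close> and \<open>move_child\<close> compute the resulting jump probabilities.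
\<close>

type_synonym mark = "bool \<times> nat"

definition mark_pmf :: "nat \<Rightarrow> real \<Rightarrow> mark pmf" where
  "mark_pmf d p = pair_pmf (bernoulli_pmf p) (pmf_of_set {..<d})"

definition move :: "vertex \<Rightarrow> mark \<Rightarrow> vertex" where
  "move v m = (if v \<noteq> [] \<and> fst m then tl v else snd m # v)"

lemma move_root:
  assumes "i < d"
  shows "pmf (map_pmf (move []) (mark_pmf d p)) [i] = 1 / real d"
proof -
  have "map_pmf (move []) (mark_pmf d p) = map_pmf (\<lambda>j. [j]) (map_pmf snd (mark_pmf d p))"
    unfolding pmf.map_comp by (rule map_pmf_cong) (simp_all add: move_def)
  also have "map_pmf snd (mark_pmf d p) = pmf_of_set {..<d}"
    by (simp add: mark_pmf_def map_snd_pair_pmf)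
  also have "pmf (map_pmf (\<lambda>j. [j]) (pmf_of_set {..<d})) [i] = pmf (pmf_of_set {..<d}) i"
    using pmf_map_inj'[of "\<lambda>j. [j]"] by (simp add: inj_def)
  also have "\<dots> = 1 / real d"
    using assms by (subst pmf_of_set) auto
  finally show ?thesis .
qed

lemma move_parent:
  assumes "v \<noteq> []" "0 \<le> p" "p \<le> 1"
  shows "pmf (map_pmf (move v) (mark_pmf d p)) (tl v) = p"
proof -
  have neq: "i # v \<noteq> tl v" for i
  proof
    assume "i # v = tl v"
    then have "length (i # v) = length (tl v)" by (rule arg_cong)
    then show False by simp
  qed
  have "move v -` {tl v} = fst -` {True}"
  proof (intro set_eqI)
    fix m show "m \<in> move v -` {tl v} \<longleftrightarrow> m \<in> fst -` {True}"
      using assms(1) neq[of "snd m"] by (cases "fst m") (simp_all add: move_def)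
  qed
  then have "pmf (map_pmf (move v) (mark_pmf d p)) (tl v)
      = pmf (map_pmf fst (mark_pmf d p)) True"
    by (simp only: pmf_map)
  also have "\<dots> = p"
    using assms by (simp add: mark_pmf_def map_fst_pair_pmf)
  finally show ?thesis .
qed

lemma move_child:
  assumes "v \<noteq> []" "0 \<le> p" "p \<le> 1" "i < d"
  shows "pmf (map_pmf (move v) (mark_pmf d p)) (i # v) = (1 - p) / real d"
proof -
  have neq: "tl v \<noteq> i # v"
  proof
    assume "tl v = i # v"
    then have "length (tl v) = length (i # v)" by (rule arg_cong)
    then show False by simp
  qed
  have "move v -` {i # v} = {(False, i)}"
  proof (intro set_eqI)
    fix m show "m \<in> move v -` {i # v} \<longleftrightarrow> m \<in> {(False, i)}"
      using assms(1) neq by (cases m; cases "fst m") (simp_all add: move_def)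
  qed
  then have "pmf (map_pmf (move v) (mark_pmf d p)) (i # v) = pmf (mark_pmf d p) (False, i)"
    by (simp only: pmf_map measure_pmf_single)
  also have "\<dots> = (1 - p) * (1 / real d)"
    using assms unfolding mark_pmf_def pmf_pair by (subst pmf_of_set) auto
  finally show ?thesis by simp
qed

primrec walk :: "vertex \<Rightarrow> mark stream \<Rightarrow> nat \<Rightarrow> vertex" where
  "walk v s 0 = v"
| "walk v s (Suc n) = move (walk v s n) (s !! n)"

text \<open>One independent stream of i.i.d. marks for the frog initially at each vertex.\<close>

definition frog_space :: "nat \<Rightarrow> real \<Rightarrow> (vertex \<Rightarrow> mark stream) measure" where
  "frog_space d p = (\<Pi>\<^sub>M v \<in> vertices d. stream_space (measure_pmf (mark_pmf d p)))"

text \<open>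
  \<open>age d \<omega> t v\<close> is the state at time \<open>t\<close> of the frog initially at \<open>v\<close>: \<open>None\<close> if it is asleep, and
  \<open>Some k\<close> if it is active and has made \<open>k\<close> jumps, its position then being \<open>walk v (\<omega> v) k\<close>.
  A frog that is woken at time \<open>t\<close> makes its first jump at time \<open>t + 1\<close>.
\<close>

primrec age :: "nat \<Rightarrow> (vertex \<Rightarrow> mark stream) \<Rightarrow> nat \<Rightarrow> vertex \<Rightarrow> nat option" where
  "age d \<omega> 0 v = (if v = [] then Some 0 else None)"
| "age d \<omega> (Suc t) v =
    (case age d \<omega> t v of
       Some k \<Rightarrow> Some (Suc k)
     | None \<Rightarrow>
         if v \<in> vertices d \<and>
            (\<exists>u\<in>vertices d. \<exists>k. age d \<omega> t u = Some k \<and> walk u (\<omega> u) (Suc k) = v)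
         then Some 0 else None)"

definition frogs_at_root :: "nat \<Rightarrow> (vertex \<Rightarrow> mark stream) \<Rightarrow> nat \<Rightarrow> vertex set" where
  "frogs_at_root d \<omega> t = {v. \<exists>k. age d \<omega> t v = Some k \<and> walk v (\<omega> v) k = []}"

lemma finite_awake: "finite {v. age d \<omega> t v \<noteq> None}"
proof (induction t)
  case (Suc t)
  have "{v. age d \<omega> (Suc t) v \<noteq> None} \<subseteq> {v. age d \<omega> t v \<noteq> None} \<union>
      (\<lambda>u. walk u (\<omega> u) (Suc (the (age d \<omega> t u)))) ` {v. age d \<omega> t v \<noteq> None}"
  proof
    fix v assume "v \<in> {v. age d \<omega> (Suc t) v \<noteq> None}"
    then have "age d \<omega> t v \<noteq> None \<or>
        (\<exists>u k. age d \<omega> t u = Some k \<and> walk u (\<omega> u) (Suc k) = v)"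
      unfolding age.simps by (auto simp del: walk.simps split: option.splits if_splits)
    then show "v \<in> {v. age d \<omega> t v \<noteq> None} \<union>
        (\<lambda>u. walk u (\<omega> u) (Suc (the (age d \<omega> t u)))) ` {v. age d \<omega> t v \<noteq> None}"
    proof (elim disjE exE conjE)
      fix u k assume u: "age d \<omega> t u = Some k" and v: "walk u (\<omega> u) (Suc k) = v"
      have "v = walk u (\<omega> u) (Suc (the (age d \<omega> t u)))"
        using u v by (simp del: walk.simps)
      then show ?thesis
        using u by blast
    qed simp
  qed
  then show ?case
    using Suc by (meson finite_UnI finite_imageI finite_subset)
qed simp

lemma finite_frogs_at_root: "finite (frogs_at_root d \<omega> t)"
  by (rule finite_subset[OF _ finite_awake[of d \<omega> t]]) (auto simp: frogs_at_root_def)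

text \<open>
  The total number of visits to the root. The presence of the initial frog at the root at
  time \<open>0\<close> is counted as a visit, which does not affect whether the total is infinite.
\<close>

definition root_visits :: "nat \<Rightarrow> (vertex \<Rightarrow> mark stream) \<Rightarrow> ennreal" where
  "root_visits d \<omega> = (\<Sum>t. of_nat (card (frogs_at_root d \<omega> t)))"

definition recurrent :: "nat \<Rightarrow> real \<Rightarrow> bool" where
  "recurrent d p \<longleftrightarrow>
    measure (frog_space d p) {\<omega> \<in> space (frog_space d p). root_visits d \<omega> = \<infinity>} = 1"

definition critical_drift :: "nat \<Rightarrow> real" where
  "critical_drift d = Inf {p \<in> {0..1}. recurrent d p}"

lemma measurable_walk:
  assumes "v \<in> vertices d"
  shows "(\<lambda>\<omega>. walk v (\<omega> v) n) \<in> measurable (frog_space d p) (count_space UNIV)"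
proof -
  have [measurable]: "(\<lambda>\<omega>. \<omega> v) \<in>
      measurable (frog_space d p) (stream_space (measure_pmf (mark_pmf d p)))"
    unfolding frog_space_def using assms by measurable
  have [measurable]: "(\<lambda>s. walk v s n) \<in>
      measurable (stream_space (measure_pmf (mark_pmf d p))) (count_space UNIV)"
  proof (induction n)
    case (Suc n)
    note Suc[measurable]
    have [measurable]: "(\<lambda>s. s !! n) \<in>
        measurable (stream_space (measure_pmf (mark_pmf d p))) (count_space UNIV)"
      using measurable_snth[of n "measure_pmf (mark_pmf d p)"] by (simp cong: measurable_cong_sets)
    show ?case by simp
  qed simp
  show ?thesis by measurable
qed

lemma age_in_vertices: "age d \<omega> t v = Some k \<Longrightarrow> v \<in> vertices d"
  by (induction t arbitrary: k) (auto simp: vertices_def split: option.splits if_splits)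

lemma measurable_age:
  "(\<lambda>\<omega>. age d \<omega> t v) \<in> measurable (frog_space d p) (count_space UNIV)"
proof (induction t arbitrary: v)
  case (Suc t)
  note Suc[measurable]
  note measurable_walk[measurable]
  show ?case
    unfolding age.simps by measurable
qed simp

lemma measurable_root_visits: "root_visits d \<in> borel_measurable (frog_space d p)"
proof -
  note measurable_age[measurable] measurable_walk[measurable]
  have at_root: "{\<omega> \<in> space (frog_space d p). v \<in> frogs_at_root d \<omega> t} \<in> sets (frog_space d p)"
    for t v
  proof (cases "v \<in> vertices d")
    case True
    then show ?thesis unfolding frogs_at_root_def by measurable
  next
    case False
    then have "v \<notin> frogs_at_root d \<omega> t" for \<omega>
      using age_in_vertices by (fastforce simp: frogs_at_root_def)
    then show ?thesis by simp
  qed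
  have [measurable]: "(\<lambda>\<omega>. card (frogs_at_root d \<omega> t)) \<in>
      measurable (frog_space d p) (count_space UNIV)" for t
  proof -
    have "card (frogs_at_root d \<omega> t) = card (to_nat ` frogs_at_root d \<omega> t)" for \<omega>
      by (simp add: card_image)
    moreover have "{\<omega> \<in> space (frog_space d p). i \<in> to_nat ` frogs_at_root d \<omega> t}
        \<in> sets (frog_space d p)" for i
    proof -
      have "{\<omega> \<in> space (frog_space d p). i \<in> to_nat ` frogs_at_root d \<omega> t} =
          (\<Union>v\<in>{v. to_nat v = i}. {\<omega> \<in> space (frog_space d p). v \<in> frogs_at_root d \<omega> t})"
        by auto
      also have "\<dots> \<in> sets (frog_space d p)"
        using at_root by (intro sets.countable_UN') auto
      finally show ?thesis .
    qed
    ultimately show ?thesis by (simp add: measurable_card)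
  qed
  show ?thesis
    unfolding root_visits_def by measurable
qed

end

theory Submission
  imports Defs "HOL-Library.Sublist"
begin

text \<open>
  The frog model is recurrent at drift \<open>p = 1/3\<close> for every \<open>d \<ge> 2\<close>, so \<open>1/3\<close> is one of the drifts over
  which the infimum is taken.

  At this drift the distance of a frog from the root grows linearly, so every frog eventually stays
  in one child subtree at each level, and the vertices with this property form a ray, the end of
  the frog. A frog visits every vertex between its starting point and its end. Keeping only these
  visits and letting at most two child subtrees of each vertex be explored leaves a process that is
  self-similar. If it already sends infinitely many frogs to the root, so does the full model.

  Reflection at the root would make the law of the end depend on the distance from the root. At
  each visit to the root an independent coin therefore decides whether the frog is killed, with a
  killing probability (\<open>kill_prob\<close>) for which the root looks like any other vertex. Then a frog
  started \<open>k\<close> levels below \<open>v\<close> ends outside the subtree of \<open>v\<close> with probability \<open>h / 2 ^ k\<close>, where \<open>h = (d - 1) / (2 d - 1)\<close>,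
  and below a given child of its starting point with probability \<open>(1 - h) / d\<close> (\<open>prob_ends\<close>). These
  numbers come from an explicit harmonic function of the killed walk, which along the walk converges
  to the indicator of the event in question (\<open>end_prob_harmonic\<close>, \<open>end_prob_tendsto\<close>).

  When a frog enters the subtree of \<open>v\<close>, it continues into a child \<open>c\<close> of \<open>v\<close> and wakes the frog at \<open>v\<close>.
  The frogs that leave the subtree of \<open>c\<close>, together with the one from \<open>v\<close>, either leave the subtree of
  \<open>v\<close> or end below another child, and one of the latter kind opens a second child subtree. Let \<open>f\<close>
  be the generating function of the number of frogs that leave the subtree of \<open>v\<close> when only \<open>n\<close> levels
  are explored. With \<open>y = (1 + x) / 2\<close> the next one is
  \<open>(h x + (1 - h) / d) f(x / 2) (1 - f(y)) + (1 - h + h x) f(y)\<^sup>2\<close> (\<open>expectation_exits\<close>).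

  This map is increasing on generating functions, and it turns the generating function \<open>exp (- a (1 - x))\<close> of a Poisson variable
  into one that lies below a Poisson generating function with a strictly larger mean
  (\<open>exit_step_exp\<close>). Iterating, the generating functions tend to \<open>0\<close> on \<open>[0, 1)\<close>, so that by Markov's
  inequality the number of visits to the root exceeds every bound almost surely. The decisive
  inequality, \<open>(1 + x) (exp (- t x) - exp (- t)) < 1 - x\<close>, is sharp enough for \<open>d = 2\<close>, which is the worst
  case: \<open>(1 - h) / d \<le> h\<close> with equality for \<open>d = 2\<close>.
\<close>

section \<open>Activated frogs and visits to the root\<close>

text \<open>
  Which frogs are ever activated is a closure property of the paths: an activated frog activates
  all frogs on its path. Infinitely many activated frogs whose paths meet the root give infinitely
  many visits, whatever the times of their activation.
\<close>

definition awake :: "nat \<Rightarrow> (vertex \<Rightarrow> mark stream) \<Rightarrow> vertex set" where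
  "awake d \<omega> = {v. \<exists>t. age d \<omega> t v \<noteq> None}"

lemma root_awake: "[] \<in> awake d \<omega>"
  by (auto simp: awake_def intro!: exI[of _ 0])

lemma age_zero_exists: "age d \<omega> t u = Some k \<Longrightarrow> \<exists>t0. age d \<omega> t0 u = Some 0"
proof (induction k arbitrary: t)
  case (Suc k)
  then show ?case
    by (cases t) (auto split: option.splits if_splits)
qed blast

lemma age_add: "age d \<omega> t u = Some 0 \<Longrightarrow> age d \<omega> (t + n) u = Some n"
  by (induction n) auto

lemma awakeE:
  assumes "u \<in> awake d \<omega>"
  obtains t where "\<And>n. age d \<omega> (t + n) u = Some n"
proof -
  obtain t k where "age d \<omega> t u = Some k" using assms by (auto simp: awake_def)
  then obtain t0 where "age d \<omega> t0 u = Some 0" using age_zero_exists by blast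
  then show thesis using age_add that by blast
qed

lemma awake_visits:
  assumes "u \<in> awake d \<omega>" "walk u (\<omega> u) n \<in> vertices d"
  shows "walk u (\<omega> u) n \<in> awake d \<omega>"
proof (cases n)
  case (Suc k)
  obtain t where t: "\<And>n. age d \<omega> (t + n) u = Some n"
    using assms(1) by (rule awakeE) blast
  have "u \<in> vertices d" using age_in_vertices t by blast
  then have "age d \<omega> (Suc (t + k)) (walk u (\<omega> u) n) \<noteq> None"
    unfolding age.simps using assms(2) t[of k] Suc by (auto simp del: walk.simps split: option.splits)
  then show ?thesis unfolding awake_def by blast
qed (use assms in simp)

lemma card_le_root_visits:
  assumes "finite F" "F \<subseteq> awake d \<omega>" "\<And>u. u \<in> F \<Longrightarrow> \<exists>n. walk u (\<omega> u) n = []"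
  shows "of_nat (card F) \<le> root_visits d \<omega>"
proof -
  have "\<exists>t. u \<in> frogs_at_root d \<omega> t" if u: "u \<in> F" for u
  proof -
    obtain n where n: "walk u (\<omega> u) n = []" using assms(3)[OF u] by blast
    obtain t where "\<And>n. age d \<omega> (t + n) u = Some n"
      using assms(2) u by (meson awakeE subsetD)
    with n show ?thesis unfolding frogs_at_root_def by blast
  qed
  then obtain \<tau> where \<tau>: "\<And>u. u \<in> F \<Longrightarrow> u \<in> frogs_at_root d \<omega> (\<tau> u)" by metis
  define T where "T = Suc (Max (\<tau> ` F))"
  have "\<tau> u < T" if "u \<in> F" for u
    using assms(1) that by (simp add: T_def less_Suc_eq_le)
  then have "F \<subseteq> (\<Union>t<T. frogs_at_root d \<omega> t)"
    using \<tau> by blast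
  then have "card F \<le> card (\<Union>t<T. frogs_at_root d \<omega> t)"
    by (intro card_mono) (auto intro: finite_frogs_at_root)
  also have "\<dots> \<le> (\<Sum>t<T. card (frogs_at_root d \<omega> t))"
    by (rule card_UN_le) simp
  finally have "ennreal (of_nat (card F)) \<le> (\<Sum>t<T. of_nat (card (frogs_at_root d \<omega> t)))"
    by (metis ennreal_of_nat_eq_real_of_nat of_nat_le_iff of_nat_sum)
  also have "\<dots> \<le> root_visits d \<omega>"
    unfolding root_visits_def by (rule sum_le_suminf) auto
  finally show ?thesis by (simp add: ennreal_of_nat_eq_real_of_nat)
qed

section \<open>The killed walk and its end\<close>

type_synonym coin_mark = "bool \<times> mark"

text \<open>
  The coin of a mark matters only at the root, where it removes the frog. Up to its removal the
  killed walk is the original walk, so its visits are visits of the original walk.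
\<close>

primrec kstep :: "vertex option \<Rightarrow> coin_mark \<Rightarrow> vertex option" where
  "kstep None m = None"
| "kstep (Some x) m = (if x = [] \<and> fst m then None else Some (move x (snd m)))"

primrec kwalk :: "vertex option \<Rightarrow> coin_mark stream \<Rightarrow> nat \<Rightarrow> vertex option" where
  "kwalk x s 0 = x"
| "kwalk x s (Suc n) = kstep (kwalk x s n) (s !! n)"

lemma walk_eq_kwalk: "kwalk (Some u) s n = Some y \<Longrightarrow> walk u (smap snd s) n = y"
proof (induction n arbitrary: y)
  case (Suc n)
  then show ?case by (cases "kwalk (Some u) s n") (auto split: if_splits)
qed simp

definition inside :: "vertex \<Rightarrow> vertex option \<Rightarrow> bool" where
  "inside w x \<longleftrightarrow> (\<exists>y. x = Some y \<and> suffix w y)"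

lemma inside_simps [simp]: "\<not> inside w None" "inside w (Some y) \<longleftrightarrow> suffix w y"
  by (auto simp: inside_def)

text \<open>
  The end of a walk is represented by the vertices whose subtree contains the walk from some time
  on. For a walk that is not killed and leaves every finite set these are the vertices of a ray
  from the root, for a killed walk there are none.
\<close>

definition ends :: "vertex \<Rightarrow> coin_mark stream \<Rightarrow> vertex set" where
  "ends u s = {w. \<forall>\<^sub>F n in sequentially. inside w (kwalk (Some u) s n)}"

text \<open>
  An exponential Lyapunov function: its summability along the walk forces the walk to leave every
  finite set or to be killed.
\<close>

primrec weight :: "vertex option \<Rightarrow> real" where
  "weight None = 0"
| "weight (Some x) = (3 / 4) ^ length x"

definition escaping :: "nat \<Rightarrow> vertex \<Rightarrow> coin_mark stream \<Rightarrow> bool" where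
  "escaping d u s \<longleftrightarrow> (\<forall>n. snd (snd (s !! n)) < d) \<and> (\<lambda>n. weight (kwalk (Some u) s n)) \<longlonglongrightarrow> 0"

lemma weight_nonneg: "0 \<le> weight x"
  by (cases x) auto

lemma escaping_far:
  assumes "escaping d u s"
  shows "\<forall>\<^sub>F n in sequentially. \<forall>y. kwalk (Some u) s n = Some y \<longrightarrow> L < length y"
proof -
  have "\<forall>\<^sub>F n in sequentially. weight (kwalk (Some u) s n) < (3/4) ^ L"
    using assms unfolding escaping_def by (auto intro: order_tendstoD)
  then show ?thesis
    by eventually_elim (auto simp: power_strict_decreasing_iff)
qed

lemma kwalk_in_vertices:
  assumes "\<And>n. snd (snd (s !! n)) < d" "u \<in> vertices d" "kwalk (Some u) s n = Some y"
  shows "y \<in> vertices d"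
  using assms(3)
proof (induction n arbitrary: y)
  case (Suc n)
  then obtain x where x: "kwalk (Some u) s n = Some x" "kstep (Some x) (s !! n) = Some y"
    by (cases "kwalk (Some u) s n") auto
  then show ?case
    using Suc.IH[OF x(1)] assms(1)[of n]
    by (cases x) (auto simp: move_def vertices_def split: if_splits)
qed (use assms in simp)

lemma kstep_enters:
  assumes "kstep (Some x) m = Some y" "suffix w y" "\<not> suffix w x"
  shows "y = w"
  using assms by (cases x) (auto simp: move_def suffix_Cons split: if_splits)

lemma kstep_leaves:
  assumes "suffix w x" "w \<noteq> []" "\<not> inside w (kstep (Some x) m)"
  shows "kstep (Some x) m = Some (tl w)"
  using assms by (cases x) (auto simp: move_def suffix_Cons split: if_splits)

text \<open>
  The walk cannot get into a subtree without stepping on its root, and (next lemma) cannot get out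
  without stepping on the parent. Hence it visits the path from its starting point to its end.
\<close>

lemma visits_of_ends:
  assumes "w \<in> ends u s" "\<not> suffix w u"
  shows "\<exists>n. kwalk (Some u) s n = Some w"
proof -
  obtain N where N: "inside w (kwalk (Some u) s N)"
    using assms(1) unfolding ends_def mem_Collect_eq eventually_sequentially by blast
  have "\<exists>n. \<not> inside w (kwalk (Some u) s n) \<and> inside w (kwalk (Some u) s (Suc n))"
  proof (rule ccontr)
    assume "\<not> ?thesis"
    then have "\<not> inside w (kwalk (Some u) s n)" for n
      using assms(2) by (induction n) auto
    then show False using N by blast
  qed
  then obtain n where n: "\<not> inside w (kwalk (Some u) s n)" "inside w (kwalk (Some u) s (Suc n))"
    by blast
  then obtain x y where "kwalk (Some u) s n = Some x" "kwalk (Some u) s (Suc n) = Some y"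
    by (cases "kwalk (Some u) s n") (auto simp: inside_def split: if_splits)
  then show ?thesis
    using n kstep_enters[of x "s !! n" y w] by fastforce
qed

lemma visits_parent_of_not_ends:
  assumes "w \<notin> ends u s" "suffix w u" "w \<noteq> []"
  shows "\<exists>n. kwalk (Some u) s n = Some (tl w)"
proof -
  have "\<exists>n. inside w (kwalk (Some u) s n) \<and> \<not> inside w (kwalk (Some u) s (Suc n))"
  proof (rule ccontr)
    assume "\<not> ?thesis"
    then have "inside w (kwalk (Some u) s n)" for n
      using assms(2) by (induction n) auto
    then show False using assms(1) by (simp add: ends_def)
  qed
  then obtain n where n: "inside w (kwalk (Some u) s n)" "\<not> inside w (kwalk (Some u) s (Suc n))"
    by blast
  then obtain x where x: "kwalk (Some u) s n = Some x" "suffix w x" by (auto simp: inside_def)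
  have "kwalk (Some u) s (Suc n) = Some (tl w)"
    using kstep_leaves[of w x "s !! n"] assms(3) n x by simp
  then show ?thesis by blast
qed

lemma ends_mono: "w \<in> ends u s \<Longrightarrow> suffix w' w \<Longrightarrow> w' \<in> ends u s"
  unfolding ends_def mem_Collect_eq
  by (erule eventually_mono) (auto simp: inside_def intro: suffix_order.trans)

lemma child_unique:
  assumes "suffix (i # w) y" "suffix (j # w) y"
  shows "i = j"
proof -
  obtain a b where "y = a @ i # w" "y = b @ j # w"
    using assms by (elim suffixE)
  then have "(a @ [i]) @ w = (b @ [j]) @ w" by simp
  then show ?thesis unfolding append_same_eq by simp
qed

lemma ends_unique:
  assumes "i # w \<in> ends u s" "j # w \<in> ends u s"
  shows "i = j"
proof -
  have "\<forall>\<^sub>F n in sequentially. inside (i # w) (kwalk (Some u) s n) \<and> inside (j # w) (kwalk (Some u) s n)"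
    using assms by (simp add: ends_def eventually_conj)
  then obtain n where "inside (i # w) (kwalk (Some u) s n)" "inside (j # w) (kwalk (Some u) s n)"
    by (auto simp: eventually_sequentially)
  then obtain y where "suffix (i # w) y" "suffix (j # w) y"
    by (auto simp: inside_def)
  then show ?thesis
    by (rule child_unique)
qed

lemma suffix_child_exists: "suffix w y \<Longrightarrow> length w < length y \<Longrightarrow> \<exists>i. suffix (i # w) y"
proof -
  assume "suffix w y" "length w < length y"
  then obtain z where z: "y = z @ w" by (elim suffixE)
  with \<open>length w < length y\<close> have "z \<noteq> []" by auto
  then obtain z' i where "z = z' @ [i]" by (metis rev_exhaust)
  then have "y = z' @ (i # w)" using z by simp
  then show ?thesis using suffixI by blast
qed

text \<open>
  Once the walk stays below \<open>w\<close> at levels beyond those of the children of \<open>w\<close>, it cannot change the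
  child subtree without returning to \<open>w\<close>.
\<close>

lemma ends_descend:
  assumes esc: "escaping d u s" and u: "u \<in> vertices d" and w: "w \<in> ends u s"
  shows "\<exists>i<d. i # w \<in> ends u s"
proof -
  have "\<forall>\<^sub>F n in sequentially. inside w (kwalk (Some u) s n) \<and>
      (\<forall>y. kwalk (Some u) s n = Some y \<longrightarrow> Suc (length w) < length y)"
    using w escaping_far[OF esc] by (auto simp: ends_def intro: eventually_conj)
  then obtain N where N: "\<And>n. n \<ge> N \<Longrightarrow> inside w (kwalk (Some u) s n)"
      "\<And>n y. n \<ge> N \<Longrightarrow> kwalk (Some u) s n = Some y \<Longrightarrow> Suc (length w) < length y"
    by (auto simp: eventually_sequentially)
  obtain y where y: "kwalk (Some u) s N = Some y" "suffix w y" "Suc (length w) < length y"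
    using N[of N] by (auto simp: inside_def)
  then obtain i where i: "suffix (i # w) y" using suffix_child_exists[of w y] by auto
  have "y \<in> vertices d"
    using kwalk_in_vertices[OF _ u y(1)] esc by (auto simp: escaping_def)
  then have "i < d" using i by (auto simp: vertices_def suffix_def)
  have "inside (i # w) (kwalk (Some u) s (N + k))" for k
  proof (induction k)
    case (Suc k)
    then obtain x where x: "kwalk (Some u) s (N + k) = Some x" "suffix (i # w) x"
      by (auto simp: inside_def)
    show ?case
    proof (rule ccontr)
      assume "\<not> ?thesis"
      then have "kwalk (Some u) s (N + Suc k) = Some w"
        using kstep_leaves[of "i # w" x "s !! (N + k)"] x by simp
      then show False using N(2)[of "N + Suc k" w] by simp
    qed
  qed (use i y in auto)
  then have "i # w \<in> ends u s"
    unfolding ends_def mem_Collect_eq eventually_sequentially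
    by (metis le_add_diff_inverse)
  with \<open>i < d\<close> show ?thesis by blast
qed

lemma root_in_ends:
  assumes "\<And>n. \<not> fst (s !! n)"
  shows "[] \<in> ends u s"
proof -
  have "kwalk (Some u) s n \<noteq> None" for n
  proof (induction n)
    case (Suc n)
    then show ?case using assms[of n] by (cases "kwalk (Some u) s n") auto
  qed simp
  then show ?thesis by (auto simp: ends_def inside_def)
qed

section \<open>The law of the end\<close>

text \<open>
  The probability \<open>h\<close> that a frog does not end below its starting point. To do so it has to reach
  the parent, which has probability \<open>1/2\<close>, and not to end below the starting point when started from
  there, so that \<open>h = (1 - (1 - h) / d) / 2\<close>.
\<close>

definition up_prob :: "nat \<Rightarrow> real" where
  "up_prob d = (real d - 1) / (2 * real d - 1)"

lemma up_prob_bounds: "d \<ge> 2 \<Longrightarrow> 0 < up_prob d" "d \<ge> 2 \<Longrightarrow> up_prob d < 1 / 2"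
  by (auto simp: up_prob_def field_simps)

lemma one_minus_up_prob: "d \<ge> 2 \<Longrightarrow> 1 - up_prob d = real d / (2 * real d - 1)"
  by (simp add: up_prob_def field_simps)

lemma same_child_le_up_prob: "d \<ge> 2 \<Longrightarrow> (1 - up_prob d) / real d \<le> up_prob d"
  unfolding one_minus_up_prob by (simp add: up_prob_def field_simps)

lemma expectation_pair_pmf:
  fixes f :: "'a \<times> 'b \<Rightarrow> real"
  assumes "finite (set_pmf A)" "finite (set_pmf B)"
  shows "measure_pmf.expectation (pair_pmf A B) f =
    measure_pmf.expectation A (\<lambda>a. measure_pmf.expectation B (\<lambda>b. f (a, b)))"
proof -
  have "measure_pmf.expectation (pair_pmf A B) f =
      (\<Sum>(a, b)\<in>set_pmf A \<times> set_pmf B. pmf A a * (pmf B b * f (a, b)))"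
    using assms by (subst integral_measure_pmf[of "set_pmf A \<times> set_pmf B"])
      (auto simp: pmf_pair mult.assoc intro!: sum.cong)
  also have "\<dots> = (\<Sum>a\<in>set_pmf A. pmf A a * (\<Sum>b\<in>set_pmf B. pmf B b * f (a, b)))"
    by (simp add: sum.cartesian_product[symmetric] sum_distrib_left)
  also have "\<dots> = measure_pmf.expectation A (\<lambda>a. measure_pmf.expectation B (\<lambda>b. f (a, b)))"
    using assms by (simp add: integral_measure_pmf[of "set_pmf A"] integral_measure_pmf[of "set_pmf B"])
  finally show ?thesis .
qed

definition coin_mark_pmf :: "nat \<Rightarrow> real \<Rightarrow> coin_mark pmf" where
  "coin_mark_pmf d k = pair_pmf (bernoulli_pmf k) (mark_pmf d (1 / 3))"

lemma set_coin_mark_pmf: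
  assumes "d \<ge> 2" "m \<in> set_pmf (coin_mark_pmf d k)"
  shows "snd (snd m) < d"
proof -
  have "{..<d} \<noteq> {}" using assms(1) by (simp add: lessThan_empty_iff)
  then show ?thesis
    using assms(2) by (auto simp: coin_mark_pmf_def mark_pmf_def set_pmf_of_set)
qed

lemma finite_set_coin_mark_pmf: "d \<ge> 2 \<Longrightarrow> finite (set_pmf (coin_mark_pmf d k))"
proof -
  assume "d \<ge> 2"
  then have "{..<d} \<noteq> {}" by (simp add: lessThan_empty_iff)
  then show ?thesis
    by (simp add: coin_mark_pmf_def mark_pmf_def set_pmf_of_set finite_subset[OF subset_UNIV])
qed

lemma expectation_kstep:
  fixes g :: "vertex option \<Rightarrow> real"
  assumes "d \<ge> 2" "0 \<le> k" "k \<le> 1"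
  shows "measure_pmf.expectation (coin_mark_pmf d k) (\<lambda>m. g (kstep (Some x) m)) =
    (if x = [] then k * g None + (1 - k) * ((\<Sum>i<d. g (Some [i])) / d)
     else g (Some (tl x)) / 3 + 2 / 3 * ((\<Sum>i<d. g (Some (i # x))) / d))"
proof -
  have ne: "{..<d} \<noteq> {}" using assms(1) by (simp add: lessThan_empty_iff)
  have "measure_pmf.expectation (coin_mark_pmf d k) (\<lambda>m. g (kstep (Some x) m)) =
      measure_pmf.expectation (bernoulli_pmf k) (\<lambda>a. measure_pmf.expectation (bernoulli_pmf (1/3))
        (\<lambda>b. measure_pmf.expectation (pmf_of_set {..<d}) (\<lambda>i. g (kstep (Some x) (a, b, i)))))"
    unfolding coin_mark_pmf_def mark_pmf_def using ne
    by (simp add: expectation_pair_pmf set_pmf_of_set finite_subset[OF subset_UNIV])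
  also have "\<dots> = (if x = [] then k * g None + (1 - k) * ((\<Sum>i<d. g (Some [i])) / d)
     else g (Some (tl x)) / 3 + 2 / 3 * ((\<Sum>i<d. g (Some (i # x))) / d))"
    using assms ne by (auto simp: integral_pmf_of_set move_def field_simps)
  finally show ?thesis .
qed

abbreviation coin_streams :: "nat \<Rightarrow> real \<Rightarrow> coin_mark stream measure" where
  "coin_streams d k \<equiv> stream_space (measure_pmf (coin_mark_pmf d k))"

lemma measurable_kwalk [measurable]:
  "(\<lambda>s. kwalk x s n) \<in> measurable (coin_streams d k) (count_space UNIV)"
proof (induction n)
  case (Suc n)
  note Suc[measurable]
  have [measurable]: "(\<lambda>s. s !! n) \<in> measurable (coin_streams d k) (count_space UNIV)"
    using measurable_snth[of n "measure_pmf (coin_mark_pmf d k)"] by (simp cong: measurable_cong_sets)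
  show ?case by simp
qed simp

lemma kwalk_Stream: "kwalk x (m ## s) (Suc n) = kwalk (kstep x m) s n"
  by (induction n) auto

lemma nn_integral_kwalk_Suc:
  "(\<integral>\<^sup>+s. f (kwalk x s (Suc n)) \<partial>coin_streams d k) =
    (\<integral>\<^sup>+m. \<integral>\<^sup>+s. f (kwalk (kstep x m) s n) \<partial>coin_streams d k \<partial>coin_mark_pmf d k)"
  for f :: "vertex option \<Rightarrow> ennreal"
  by (subst prob_space.nn_integral_stream_space[OF prob_space_measure_pmf]) (simp_all add: kwalk_Stream del: kwalk.simps)

lemma prob_space_coin_streams: "prob_space (coin_streams d k)"
  by (rule prob_space.prob_space_stream_space[OF prob_space_measure_pmf])

text \<open>
  Away from the root the mean of the weight is multiplied by
  \<open>1/3 \<cdot> 4/3 + 2/3 \<cdot> 3/4 = 17/18\<close> in each step. At the root it decreases even faster.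
\<close>

lemma nn_integral_weight_kwalk:
  assumes "d \<ge> 2" "0 \<le> k" "k \<le> 1"
  shows "(\<integral>\<^sup>+s. ennreal (weight (kwalk x s n)) \<partial>coin_streams d k) \<le> ennreal ((17 / 18) ^ n * weight x)"
proof (induction n arbitrary: x)
  case 0
  interpret prob_space "coin_streams d k" by (rule prob_space_coin_streams)
  show ?case by (simp add: emeasure_space_1)
next
  case (Suc n)
  have step: "measure_pmf.expectation (coin_mark_pmf d k) (\<lambda>m. weight (kstep x m)) \<le> 17 / 18 * weight x"
  proof (cases x)
    case (Some v)
    have "measure_pmf.expectation (coin_mark_pmf d k) (\<lambda>m. weight (kstep (Some v) m)) \<le> 17 / 18 * weight (Some v)"
      unfolding expectation_kstep[OF assms] using assms by (cases v) auto
    with Some show ?thesis by simp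
  qed simp
  have "(\<integral>\<^sup>+s. ennreal (weight (kwalk x s (Suc n))) \<partial>coin_streams d k) \<le>
      (\<integral>\<^sup>+m. ennreal ((17 / 18) ^ n * weight (kstep x m)) \<partial>coin_mark_pmf d k)"
    unfolding nn_integral_kwalk_Suc[where f = "\<lambda>y. ennreal (weight y)"] by (intro nn_integral_mono Suc.IH)
  also have "\<dots> = ennreal (measure_pmf.expectation (coin_mark_pmf d k) (\<lambda>m. (17 / 18) ^ n * weight (kstep x m)))"
    using finite_set_coin_mark_pmf[OF assms(1)] weight_nonneg
    by (intro nn_integral_eq_integral integrable_measure_pmf_finite) auto
  also have "\<dots> \<le> ennreal ((17 / 18) ^ Suc n * weight x)"
    using step by (intro ennreal_leI) (simp add: field_simps)
  finally show ?case .
qed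

lemma AE_escaping:
  assumes "d \<ge> 2" "0 \<le> k" "k \<le> 1"
  shows "AE s in coin_streams d k. escaping d u s"
proof -
  have idx: "AE s in coin_streams d k. stream_all (\<lambda>m. snd (snd m) < d) s"
    using set_coin_mark_pmf[OF assms(1)]
    by (intro prob_space.AE_stream_all[OF prob_space_measure_pmf]) (auto simp: AE_measure_pmf_iff)
  have "(\<integral>\<^sup>+s. (\<Sum>n. ennreal (weight (kwalk (Some u) s n))) \<partial>coin_streams d k) \<le>
      (\<Sum>n. ennreal ((17 / 18) ^ n * weight (Some u)))"
    by (subst nn_integral_suminf) (simp, intro suminf_le nn_integral_weight_kwalk assms summableI)
  also have "\<dots> = ennreal (\<Sum>n. (17 / 18) ^ n * weight (Some u))"
    by (intro suminf_ennreal2 summable_mult2 summable_geometric) (auto simp: weight_nonneg)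
  also have "\<dots> < \<infinity>" by simp
  finally have "AE s in coin_streams d k. (\<Sum>n. ennreal (weight (kwalk (Some u) s n))) \<noteq> \<infinity>"
    by (intro nn_integral_PInf_AE) auto
  then have "AE s in coin_streams d k. (\<lambda>n. weight (kwalk (Some u) s n)) \<longlonglongrightarrow> 0"
    by eventually_elim (auto intro!: summable_LIMSEQ_zero summable_suminf_not_top simp: weight_nonneg)
  with idx show ?thesis
    by eventually_elim (simp add: escaping_def stream_all_def)
qed

text \<open>
  Let \<open>z\<close> be the last common vertex of the paths from the root to \<open>x\<close> and to \<open>w\<close>. A walk started at
  \<open>x\<close> outside the subtree of \<open>w\<close> reaches \<open>z\<close> with probability \<open>1/2\<close> per level. From \<open>z\<close> it ends below
  \<open>z\<close> with probability \<open>1 - h\<close>, and then every descendant of \<open>z\<close> on the level of \<open>w\<close> is equally likely.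
  The recursion multiplies these factors.
\<close>

primrec outside_prob :: "nat \<Rightarrow> vertex \<Rightarrow> vertex \<Rightarrow> real" where
  "outside_prob d w [] = (1 - up_prob d) / real d ^ length w"
| "outside_prob d w (i # x) = (if suffix (i # x) w then (1 - up_prob d) / real d ^ (length w - length (i # x))
      else outside_prob d w x / 2)"

text \<open>
  From a point \<open>k\<close> levels below \<open>w\<close> the walk has to climb to \<open>w\<close> and then to end outside the subtree
  of \<open>w\<close>, which accounts for \<open>h / 2 ^ k\<close>.
\<close>

definition end_prob :: "nat \<Rightarrow> vertex \<Rightarrow> vertex option \<Rightarrow> real" where
  "end_prob d w y = (case y of None \<Rightarrow> 0 | Some x \<Rightarrow>
     if suffix w x then 1 - up_prob d * (1 / 2) ^ (length x - length w) else outside_prob d w x)"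

lemma end_prob_simps:
  "end_prob d w None = 0"
  "suffix w x \<Longrightarrow> end_prob d w (Some x) = 1 - up_prob d * (1 / 2) ^ (length x - length w)"
  "\<not> suffix w x \<Longrightarrow> end_prob d w (Some x) = outside_prob d w x"
  by (auto simp: end_prob_def)

lemma outside_prob_ancestor: "suffix x w \<Longrightarrow> outside_prob d w x = (1 - up_prob d) / real d ^ (length w - length x)"
  by (cases x) auto

lemma outside_prob_bounds:
  assumes "d \<ge> 2"
  shows "0 \<le> outside_prob d w x \<and> outside_prob d w x \<le> (1 / 2) ^ (length x - length w)"
proof -
  have le1: "(1 - up_prob d) / real d ^ n \<le> 1" for n
  proof -
    have "1 \<le> real d ^ n" using assms by (intro one_le_power) simp
    then have "1 - up_prob d \<le> 1 * real d ^ n" using up_prob_bounds[OF assms] by linarith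
    then show ?thesis using \<open>1 \<le> real d ^ n\<close> using assms by (subst pos_divide_le_eq) auto
  qed
  have nn: "0 \<le> (1 - up_prob d) / real d ^ n" for n
    using up_prob_bounds[OF assms] by simp
  show ?thesis
  proof (induction x)
    case (Cons i x)
    show ?case
    proof (cases "suffix (i # x) w")
      case True
      then show ?thesis using le1 nn suffix_length_le[OF True] by simp
    next
      case False
      have "(1 / 2 :: real) ^ (length x - length w) / 2 \<le> (1 / 2) ^ (length (i # x) - length w)"
        by (cases "length w \<le> length x") (auto simp: Suc_diff_le)
      then show ?thesis using Cons False by simp
    qed
  qed (use le1 nn in simp)
qed

lemma end_prob_bounds:
  assumes "d \<ge> 2"
  shows "0 \<le> end_prob d w y \<and> end_prob d w y \<le> 1"
proof (cases y)
  case (Some x)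
  have "up_prob d * (1 / 2) ^ n \<le> 1 * 1" for n
    using up_prob_bounds[OF assms] by (intro mult_mono power_le_one) auto
  moreover have "(1 / 2 :: real) ^ n \<le> 1" for n by (intro power_le_one) auto
  ultimately show ?thesis
    using Some outside_prob_bounds[OF assms, of w x] up_prob_bounds[OF assms]
    by (auto simp: end_prob_def intro: order_trans)
qed (simp add: end_prob_simps)

text \<open>
  The solution of \<open>(1 - kill_prob) (1 - h / 2) = 1 - h\<close>: with this killing probability a walk started at
  the root survives with probability \<open>1 - h\<close>, the probability with which a walk started at any other
  vertex ends below that vertex.
\<close>

definition kill_prob :: "nat \<Rightarrow> real" where
  "kill_prob d = (real d - 1) / (3 * real d - 1)"

lemma kill_prob_bounds: "d \<ge> 2 \<Longrightarrow> 0 \<le> kill_prob d" "d \<ge> 2 \<Longrightarrow> kill_prob d \<le> 1"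
  by (auto simp: kill_prob_def field_simps)

lemma sum_children_inside:
  "suffix w x \<Longrightarrow> (\<Sum>i<d. end_prob d w (Some (i # x))) = 
    real d * (1 - up_prob d * (1 / 2) ^ Suc (length x - length w))"
  by (simp add: end_prob_simps suffix_Cons Suc_diff_le suffix_length_le)

lemma sum_children_ancestor:
  assumes "d \<ge> 2" "w \<in> vertices d" "suffix x w" "x \<noteq> w"
  shows "(\<Sum>i<d. end_prob d w (Some (i # x))) = (real d + (real d - 1) / 2) * outside_prob d w x"
proof -
  have len: "length x < length w"
  proof -
    obtain z where "w = z @ x" using assms(3) by (elim suffixE)
    then show ?thesis using assms(4) by (cases z) auto
  qed
  then obtain j where j: "suffix (j # x) w" using suffix_child_exists assms(3) by blast
  have jd: "j < d" using j assms(2) by (auto simp: vertices_def suffix_def)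
  have nw: "\<not> suffix w x" using len by (auto dest: suffix_length_le)
  have pow: "real d ^ (length w - length x) = real d * real d ^ (length w - Suc (length x))"
    using len by (metis Suc_diff_Suc power_Suc)
  have one: "end_prob d w (Some (j # x)) = real d * outside_prob d w x"
  proof (cases "w = j # x")
    case True
    then show ?thesis using assms outside_prob_ancestor[OF assms(3), of d] nw by (simp add: end_prob_simps)
  next
    case False
    then have "\<not> suffix w (j # x)" using nw by (simp add: suffix_Cons)
    then show ?thesis
      using assms(1) outside_prob_ancestor[OF assms(3), of d] outside_prob_ancestor[OF j, of d] pow by (simp add: end_prob_simps)
  qed
  have other: "end_prob d w (Some (i # x)) = outside_prob d w x / 2" if "i \<noteq> j" for i
  proof -
    have "\<not> suffix (i # x) w" using child_unique[OF j] that by blast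
    then show ?thesis using nw by (auto simp: end_prob_simps suffix_Cons)
  qed
  have "(\<Sum>i<d. end_prob d w (Some (i # x))) =
      end_prob d w (Some (j # x)) + (\<Sum>i\<in>{..<d} - {j}. end_prob d w (Some (i # x)))"
    using jd by (intro sum.remove) auto
  also have "(\<Sum>i\<in>{..<d} - {j}. end_prob d w (Some (i # x))) = (\<Sum>i\<in>{..<d} - {j}. outside_prob d w x / 2)"
    using other by (intro sum.cong) auto
  also have "\<dots> = (real d - 1) * (outside_prob d w x / 2)"
    using jd by (simp add: of_nat_diff)
  finally show ?thesis unfolding one by (simp add: algebra_simps)
qed

lemma sum_children_off_path:
  assumes "\<not> suffix w x" "\<not> suffix x w"
  shows "(\<Sum>i<d. end_prob d w (Some (i # x))) = real d * (outside_prob d w x / 2)"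
proof -
  have "end_prob d w (Some (i # x)) = outside_prob d w x / 2" for i
  proof -
    have "\<not> suffix (i # x) w" using assms(2) by (auto simp: suffix_def)
    moreover have "\<not> suffix w (i # x)" using assms by (auto simp: suffix_Cons)
    ultimately show ?thesis by (simp add: end_prob_simps)
  qed
  note child = this
  show ?thesis unfolding child by simp
qed

text \<open>
  There are three positions of \<open>x\<close> relative to \<open>w\<close>. Off the path to \<open>w\<close> and strictly below \<open>w\<close> the function
  is affine in \<open>2\<close> to the power of minus the level, which is harmonic for drift \<open>1/3\<close>. At \<open>w\<close> and on the
  path above it, harmonicity amounts to the defining equations of \<open>h\<close> and of the killing probability.
\<close>

lemma end_prob_harmonic:
  assumes d: "d \<ge> 2" and w: "w \<in> vertices d"
  shows "measure_pmf.expectation (coin_mark_pmf d (kill_prob d)) (\<lambda>m. end_prob d w (kstep y m)) = end_prob d w y"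
proof (cases y)
  case (Some x)
  note E = expectation_kstep[OF d kill_prob_bounds[OF d], of "end_prob d w"]
  have dd: "real d \<ge> 2" using d by simp
  define q r where "q = 2 * real d - 1" and "r = 3 * real d - 1"
  have qr: "q > 0" "r > 0" "r / 2 = (3 * q + 1) / 4" "real d = (q + 1) / 2"
    using dd by (auto simp: q_def r_def)
  have up: "up_prob d = (q - 1) / 2 / q"
    unfolding up_prob_def q_def[symmetric] by (simp add: qr(4) field_simps)
  have one_minus: "1 - up_prob d = real d / q"
    using one_minus_up_prob[OF d] by (simp add: q_def)
  have half: "1 - up_prob d / 2 = r / 2 / q"
    unfolding up qr(3) using qr(1) by (simp add: field_simps)
  have kill: "1 - kill_prob d = 2 * real d / r"
    unfolding kill_prob_def r_def[symmetric] using qr(2) by (simp add: r_def field_simps)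
  have step: "1 - up_prob d = (1 - up_prob d) / real d / 3 + 2 / 3 * (1 - up_prob d / 2)"
  proof -
    have "(1 - up_prob d) / real d = 1 / q" unfolding one_minus using dd by simp
    then show ?thesis unfolding half one_minus using qr(1) by (simp add: r_def field_simps)
  qed
  have root1: "(1 - kill_prob d) * (1 - up_prob d / 2) = 1 - up_prob d"
    unfolding kill half one_minus using qr by simp
  have root2: "(1 - kill_prob d) * (real d + (real d - 1) / 2) / real d = 1"
  proof -
    have children: "real d + (real d - 1) / 2 = r / 2" by (simp add: r_def field_simps)
    show ?thesis unfolding kill children using qr(2) dd by simp
  qed
  consider (inside) "suffix w x" | (ancestor) "suffix x w" "x \<noteq> w" | (off) "\<not> suffix w x" "\<not> suffix x w"
    using suffix_order.refl by blast
  then have "measure_pmf.expectation (coin_mark_pmf d (kill_prob d)) (\<lambda>m. end_prob d w (kstep (Some x) m))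
      = end_prob d w (Some x)"
  proof cases
    case inside
    show ?thesis
    proof (cases "x = []")
      case True
      then show ?thesis using inside sum_children_inside[OF inside, of d] dd root1 unfolding E
        by (simp add: end_prob_simps)
    next
      case False
      show ?thesis
      proof (cases "x = w")
        case True
        obtain i x' where x: "x = i # x'" using False by (cases x) auto
        have "\<not> suffix w x'" using x True by (auto dest: suffix_length_le)
        then have "end_prob d w (Some (tl x)) = (1 - up_prob d) / real d"
          using x True outside_prob_ancestor[of x' w d] by (simp add: end_prob_simps suffix_Cons)
        then show ?thesis using False True sum_children_inside[OF inside, of d] dd step unfolding E
          by (simp add: end_prob_simps)
      next
        case False2: False
        then obtain i x' where x: "x = i # x'" "suffix w x'" using inside False by (cases x) (auto simp: suffix_Cons)
        have len: "Suc (length x') - length w = Suc (length x' - length w)"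
          using suffix_length_le[OF x(2)] by (simp add: Suc_diff_le)
        have "(\<Sum>i<d. end_prob d w (Some (i # x))) / real d
            = 1 - up_prob d * (1 / 2) ^ Suc (length x - length w)"
          unfolding sum_children_inside[OF inside] using dd by simp
        then show ?thesis
          unfolding E end_prob_simps(2)[OF inside] using x False end_prob_simps(2)[OF x(2), of d]
          by (simp add: len) (simp add: field_simps)
      qed
    qed
  next
    case ancestor
    have nw: "\<not> suffix w x" using ancestor by (meson suffix_order.antisym)
    note S = sum_children_ancestor[OF d w ancestor]
    show ?thesis
    proof (cases x)
      case Nil
      have "measure_pmf.expectation (coin_mark_pmf d (kill_prob d)) (\<lambda>m. end_prob d w (kstep (Some x) m))
          = (1 - kill_prob d) * (real d + (real d - 1) / 2) / real d * outside_prob d w x"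
        unfolding E using Nil S by (simp add: end_prob_simps mult.assoc mult.commute mult.left_commute)
      then show ?thesis unfolding root2 using nw by (simp add: end_prob_simps)
    next
      case (Cons i x')
      have anc: "suffix x' w" using ancestor Cons by (auto simp: suffix_def)
      have "length x' < length w" using ancestor(1) Cons by (auto dest: suffix_length_le)
      then have "real d ^ (length w - length x') = real d * real d ^ (length w - length x)"
        using Cons by (metis Suc_diff_Suc power_Suc length_Cons)
      then have "outside_prob d w x' = outside_prob d w x / real d"
        using outside_prob_ancestor[OF anc, of d] outside_prob_ancestor[OF ancestor(1), of d] by simp
      moreover have "\<not> suffix w x'" using nw Cons by (auto simp: suffix_Cons)
      ultimately have parent: "end_prob d w (Some (tl x)) = outside_prob d w x / real d"
        using Cons by (simp add: end_prob_simps del: outside_prob.simps)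
      have "x \<noteq> []" using Cons by simp
      have "measure_pmf.expectation (coin_mark_pmf d (kill_prob d)) (\<lambda>m. end_prob d w (kstep (Some x) m))
          = outside_prob d w x / real d / 3 + 2 / 3 * ((real d + (real d - 1) / 2) * outside_prob d w x / real d)"
        unfolding E parent S if_not_P[OF \<open>x \<noteq> []\<close>] ..
      also have "\<dots> = outside_prob d w x" using dd by (simp add: field_simps)
      finally show ?thesis using nw by (simp add: end_prob_simps)
    qed
  next
    case off
    obtain i x' where x: "x = i # x'" using off by (cases x) auto
    have "\<not> suffix w x'" using off x by (auto simp: suffix_Cons)
    then have parent: "end_prob d w (Some (tl x)) = 2 * outside_prob d w x"
      using off x by (simp add: end_prob_simps)
    have "x \<noteq> []" using x by simp
    have "measure_pmf.expectation (coin_mark_pmf d (kill_prob d)) (\<lambda>m. end_prob d w (kstep (Some x) m))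
        = 2 * outside_prob d w x / 3 + 2 / 3 * (real d * (outside_prob d w x / 2) / real d)"
      unfolding E parent sum_children_off_path[OF off] if_not_P[OF \<open>x \<noteq> []\<close>] ..
    also have "\<dots> = outside_prob d w x" using dd by simp
    finally show ?thesis using off(1) by (simp add: end_prob_simps)
  qed
  with Some show ?thesis by simp
qed (simp add: end_prob_simps)

lemma integral_end_prob_kwalk:
  assumes d: "d \<ge> 2" and w: "w \<in> vertices d"
  shows "integral\<^sup>L (coin_streams d (kill_prob d)) (\<lambda>s. end_prob d w (kwalk x s n)) = end_prob d w x"
proof -
  have "(\<integral>\<^sup>+s. ennreal (end_prob d w (kwalk x s n)) \<partial>coin_streams d (kill_prob d)) = ennreal (end_prob d w x)"
  proof (induction n arbitrary: x)
    case 0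
    interpret prob_space "coin_streams d (kill_prob d)" by (rule prob_space_coin_streams)
    show ?case by (simp add: emeasure_space_1)
  next
    case (Suc n)
    have "(\<integral>\<^sup>+s. ennreal (end_prob d w (kwalk x s (Suc n))) \<partial>coin_streams d (kill_prob d)) =
        (\<integral>\<^sup>+m. ennreal (end_prob d w (kstep x m)) \<partial>coin_mark_pmf d (kill_prob d))"
      unfolding nn_integral_kwalk_Suc[where f = "\<lambda>y. ennreal (end_prob d w y)"] Suc.IH ..
    also have "\<dots> = ennreal (measure_pmf.expectation (coin_mark_pmf d (kill_prob d)) (\<lambda>m. end_prob d w (kstep x m)))"
      using finite_set_coin_mark_pmf[OF d] end_prob_bounds[OF d]
      by (intro nn_integral_eq_integral integrable_measure_pmf_finite) auto
    finally show ?case unfolding end_prob_harmonic[OF d w] .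
  qed
  then show ?thesis
    using end_prob_bounds[OF d] by (subst integral_eq_nn_integral) auto
qed

text \<open>
  Deep in the tree the end is almost decided: \<open>end_prob d w\<close> differs from \<open>0\<close> or \<open>1\<close>, according to the
  side of \<open>w\<close>, by at most \<open>2\<close> to the power of minus the depth relative to \<open>w\<close>. The walk eventually
  settles on one side, because changing sides requires a visit to \<open>w\<close>.
\<close>

lemma end_prob_tendsto:
  assumes d: "d \<ge> 2" and esc: "escaping d u s"
  shows "(\<lambda>n. end_prob d w (kwalk (Some u) s n)) \<longlonglongrightarrow> of_bool (w \<in> ends u s)"
proof -
  have dich: "\<forall>\<^sub>F n in sequentially. inside w (kwalk (Some u) s n) \<longleftrightarrow> w \<in> ends u s"
  proof (cases "w \<in> ends u s")
    case False
    obtain N where N: "\<And>n y. n \<ge> N \<Longrightarrow> kwalk (Some u) s n = Some y \<Longrightarrow> length w < length y"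
      using escaping_far[OF esc, of "length w"] by (auto simp: eventually_sequentially)
    have "\<not> inside w (kwalk (Some u) s n)" if "n \<ge> N" for n
    proof
      assume "inside w (kwalk (Some u) s n)"
      then have "inside w (kwalk (Some u) s (n + k))" for k
      proof (induction k)
        case (Suc k)
        then obtain x where x: "kwalk (Some u) s (n + k) = Some x" "suffix w x"
          by (auto simp: inside_def)
        show ?case
        proof (rule ccontr)
          assume *: "\<not> ?thesis"
          have "kwalk (Some u) s (n + Suc k) = Some (tl w)"
          proof (cases "w = []")
            case True
            have "length w < length x" using N[OF _ x(1)] that by simp
            then show ?thesis using True x * by auto
          next
            case False
            then show ?thesis using kstep_leaves[of w x "s !! (n + k)"] x * by simp
          qed
          then show False using N[of "n + Suc k" "tl w"] that by simp
        qed
      qed simp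
      then have "\<forall>\<^sub>F m in sequentially. inside w (kwalk (Some u) s m)"
        unfolding eventually_sequentially by (metis le_add_diff_inverse)
      then show False using False by (simp add: ends_def)
    qed
    then show ?thesis using False by (auto simp: eventually_sequentially)
  qed (simp add: ends_def)
  show ?thesis
  proof (rule tendstoI)
    fix e :: real assume "0 < e"
    then obtain L where L: "(1 / 2 :: real) ^ L < e" using real_arch_pow_inv[of e "1/2"] by auto
    show "\<forall>\<^sub>F n in sequentially. dist (end_prob d w (kwalk (Some u) s n)) (of_bool (w \<in> ends u s)) < e"
      using dich escaping_far[OF esc, of "length w + L"]
    proof eventually_elim
      case (elim n)
      show ?case
      proof (cases "kwalk (Some u) s n")
        case None
        then show ?thesis using elim \<open>0 < e\<close> by (simp add: end_prob_simps)
      next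
        case (Some y)
        have "(1 / 2 :: real) ^ (length y - length w) \<le> (1 / 2) ^ L"
          using elim(2) Some by (intro power_decreasing) auto
        then have small: "(1 / 2 :: real) ^ (length y - length w) < e" using L by (rule le_less_trans)
        have "up_prob d * (1 / 2) ^ (length y - length w) \<le> 1 * (1 / 2) ^ (length y - length w)"
          using up_prob_bounds[OF d] by (intro mult_right_mono) auto
        then have "up_prob d * (1 / 2) ^ (length y - length w) < e" using small by linarith
        moreover have "0 \<le> up_prob d * (1 / 2) ^ (length y - length w)"
          using up_prob_bounds[OF d] by simp
        ultimately show ?thesis
          using elim(1) Some small outside_prob_bounds[OF d, of w y]
          by (cases "suffix w y") (auto simp: end_prob_simps dist_real_def)
      qed
    qed
  qed
qed

lemma measurable_ends [measurable]:
  "Measurable.pred (coin_streams d k) (\<lambda>s. w \<in> ends u s)"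
  unfolding ends_def mem_Collect_eq eventually_sequentially by measurable

text \<open>
  The mean of the harmonic function along the walk is constant, and by dominated convergence it
  tends to the probability of the event.
\<close>

lemma prob_ends:
  assumes d: "d \<ge> 2" and w: "w \<in> vertices d"
  shows "measure (coin_streams d (kill_prob d)) {s \<in> space (coin_streams d (kill_prob d)). w \<in> ends u s}
    = end_prob d w (Some u)"
proof -
  define M where "M = coin_streams d (kill_prob d)"
  interpret prob_space M unfolding M_def by (rule prob_space_coin_streams)
  have [measurable]: "(\<lambda>s. kwalk (Some u) s n) \<in> measurable M (count_space UNIV)" for n
    unfolding M_def by measurable
  have [measurable]: "Measurable.pred M (\<lambda>s. w \<in> ends u s)" unfolding M_def by measurable
  have "(\<lambda>n. integral\<^sup>L M (\<lambda>s. end_prob d w (kwalk (Some u) s n))) \<longlonglongrightarrow>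
      integral\<^sup>L M (\<lambda>s. of_bool (w \<in> ends u s))"
  proof (rule integral_dominated_convergence[where w = "\<lambda>_. 1"])
    show "AE s in M. (\<lambda>n. end_prob d w (kwalk (Some u) s n)) \<longlonglongrightarrow> of_bool (w \<in> ends u s)"
      using AE_escaping[OF d kill_prob_bounds[OF d], of u] unfolding M_def
      by eventually_elim (rule end_prob_tendsto[OF d])
  qed (use end_prob_bounds[OF d] in auto)
  then have "end_prob d w (Some u) = integral\<^sup>L M (\<lambda>s. of_bool (w \<in> ends u s))"
    unfolding M_def integral_end_prob_kwalk[OF d w] by (simp add: LIMSEQ_const_iff)
  also have "\<dots> = integral\<^sup>L M (indicator {s \<in> space M. w \<in> ends u s})"
    by (intro Bochner_Integration.integral_cong) auto
  also have "\<dots> = measure M {s \<in> space M. w \<in> ends u s}" by simp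
  finally show ?thesis by (simp add: M_def)
qed

section \<open>The exploration process of a subtree\<close>

definition subtree :: "nat \<Rightarrow> nat \<Rightarrow> vertex \<Rightarrow> vertex set" where
  "subtree d n v = {s @ v | s. s \<in> vertices d \<and> length s < n}"

lemma finite_subtree [simp]: "finite (subtree d n v)"
proof -
  have "subtree d n v \<subseteq> (\<lambda>s. s @ v) ` {s. set s \<subseteq> {..<d} \<and> length s \<le> n}"
    by (auto simp: subtree_def vertices_def)
  then show ?thesis
    by (rule finite_subset) (intro finite_imageI finite_lists_length_le finite_lessThan)
qed

lemma subtree_child: "i < d \<Longrightarrow> subtree d n (i # v) \<subseteq> subtree d (Suc n) v"
proof
  fix u assume "i < d" "u \<in> subtree d n (i # v)"
  then obtain s where "u = (s @ [i]) @ v" "s \<in> vertices d" "length s < n" by (auto simp: subtree_def)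
  then show "u \<in> subtree d (Suc n) v"
    using \<open>i < d\<close> unfolding subtree_def by (auto simp: vertices_def intro!: exI[of _ "s @ [i]"])
qed

lemma subtree_self: "v \<in> subtree d (Suc n) v"
  by (auto simp: subtree_def vertices_def)

lemma subtree_suffix: "u \<in> subtree d n v \<Longrightarrow> suffix v u"
  by (auto simp: subtree_def suffix_def)

lemma subtree_children_disjoint:
  assumes "u \<in> subtree d n (i # v)" "u \<in> subtree d m (j # v)"
  shows "i = j"
  using subtree_suffix[OF assms(1)] subtree_suffix[OF assms(2)] by (rule child_unique)

lemma subtree_vertices: "v \<in> vertices d \<Longrightarrow> u \<in> subtree d n v \<Longrightarrow> u \<in> vertices d"
  by (auto simp: subtree_def vertices_def)

lemma subtree_length: "u \<in> subtree d n v \<Longrightarrow> length v \<le> length u \<and> length u < length v + n"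
  by (auto simp: subtree_def)

lemma subtree_child_not_self: "v \<notin> subtree d n (i # v)"
  using subtree_length[of v d n "i # v"] by auto

text \<open>
  In the following a ray is given by the set of its vertices. The index set \<open>X\<close> excludes the child
  from which the frog has come.
\<close>

definition crosses :: "nat \<Rightarrow> nat set \<Rightarrow> vertex \<Rightarrow> vertex set \<Rightarrow> bool" where
  "crosses d X v e \<longleftrightarrow> (\<exists>i<d. i \<notin> X \<and> i # v \<in> e)"

text \<open>
  The default value \<open>0\<close> makes the result a legitimate child index for arbitrary sets \<open>e\<close>, so that the
  exploration process has the same law for every entering ray, including degenerate ones.
\<close>

definition child :: "nat \<Rightarrow> nat set \<Rightarrow> vertex \<Rightarrow> vertex set \<Rightarrow> nat" where
  "child d X v e = (if crosses d X v e then SOME i. i < d \<and> i \<notin> X \<and> i # v \<in> e else 0)"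

lemma child_props:
  assumes "crosses d X v e"
  shows "child d X v e < d" "child d X v e \<notin> X" "child d X v e # v \<in> e"
  using someI_ex[OF assms[unfolded crosses_def]] assms by (auto simp: child_def)

lemma child_less: "d > 0 \<Longrightarrow> child d X v e < d"
  using child_props(1) by (cases "crosses d X v e") (auto simp: child_def)

text \<open>
  The frogs started at most \<open>n - 1\<close> levels below \<open>v\<close> that leave the subtree of \<open>v\<close> after a frog
  with ray \<open>R\<close> has entered it; \<open>\<delta> u\<close> is the ray of the frog \<open>u\<close>. The entering frog continues to the
  child \<open>c\<close>, \<open>A\<close> consists of the frogs that are activated at \<open>v\<close> or return to \<open>v\<close> from below \<open>c\<close>, and a
  single member of \<open>A\<close> whose ray continues to a different child enters a second child subtree. All
  further frogs with such a ray are discarded, which keeps the explored child subtrees independent.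
\<close>

primrec exits :: "nat \<Rightarrow> nat \<Rightarrow> vertex \<Rightarrow> vertex set \<Rightarrow> (vertex \<Rightarrow> vertex set) \<Rightarrow> vertex set" where
  "exits d 0 v R \<delta> = {}"
| "exits d (Suc n) v R \<delta> =
    (let c = child d {} v R;
         A = insert v (exits d n (c # v) R \<delta>);
         B = {u \<in> A. crosses d {c} v (\<delta> u)};
         e = \<delta> (SOME u. u \<in> B);
         C = (if B = {} then {} else exits d n (child d {c} v e # v) e \<delta>)
     in {u \<in> A \<union> C. v \<notin> \<delta> u})"

lemma exits_subset:
  assumes "d > 0"
  shows "exits d n v R \<delta> \<subseteq> subtree d n v"
proof (induction n arbitrary: v R)
  case (Suc n)
  have "exits d n (child d X v e # v) e' \<delta> \<subseteq> subtree d (Suc n) v" for X e e'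
    using Suc[of "child d X v e # v" e'] subtree_child[OF child_less[OF assms]] by blast
  then show ?case
    by (auto simp: Let_def subtree_self)
qed simp

lemma exits_leave: "u \<in> exits d n v R \<delta> \<Longrightarrow> v \<notin> \<delta> u"
  by (cases n) (auto simp: Let_def)

text \<open>
  The exploration of a subtree reads the rays of the frogs of this subtree only. This is the source
  of all independence below.
\<close>

lemma exits_cong:
  assumes "d > 0" "\<And>u. u \<in> subtree d n v \<Longrightarrow> \<delta> u = \<delta>' u"
  shows "exits d n v R \<delta> = exits d n v R \<delta>'"
  using assms(2)
proof (induction n arbitrary: v R)
  case (Suc n)
  have IH: "exits d n (child d X v e # v) e' \<delta> = exits d n (child d X v e # v) e' \<delta>'" for X e e'
    using subtree_child[OF child_less[OF assms(1)]] by (intro Suc.IH Suc.prems) blast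
  define c A where "c = child d {} v R" and "A = insert v (exits d n (c # v) R \<delta>)"
  have A': "insert v (exits d n (c # v) R \<delta>') = A" by (simp add: A_def c_def IH)
  have sub: "A \<subseteq> subtree d (Suc n) v"
    using exits_subset[OF assms(1), of n "c # v" R \<delta>] subtree_child[OF child_less[OF assms(1), of "{}" v R], of n v]
      subtree_self[of v d n] unfolding A_def c_def by blast
  define B where "B = {u \<in> A. crosses d {c} v (\<delta> u)}"
  have B': "{u \<in> A. crosses d {c} v (\<delta>' u)} = B"
    using sub Suc.prems unfolding B_def by auto
  define e where "e = \<delta> (SOME u. u \<in> B)"
  have e': "\<delta>' (SOME u. u \<in> B) = e" if "B \<noteq> {}"
  proof -
    have "(SOME u. u \<in> B) \<in> B" using that by (simp add: some_in_eq)
    then have "(SOME u. u \<in> B) \<in> subtree d (Suc n) v" using sub by (auto simp: B_def)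
    then show ?thesis using Suc.prems by (simp add: e_def)
  qed
  define C where "C = (if B = {} then {} else exits d n (child d {c} v e # v) e \<delta>)"
  have C': "(if B = {} then {} else exits d n (child d {c} v (\<delta>' (SOME u. u \<in> B)) # v) (\<delta>' (SOME u. u \<in> B)) \<delta>') = C"
    using e' by (auto simp: C_def IH)
  have subC: "C \<subseteq> subtree d (Suc n) v"
    using exits_subset[OF assms(1), of n "child d {c} v e # v" e \<delta>]
      subtree_child[OF child_less[OF assms(1), of "{c}" v e], of n v] unfolding C_def by auto
  have l: "exits d (Suc n) v R \<delta> = {u \<in> A \<union> C. v \<notin> \<delta> u}"
    unfolding exits.simps Let_def c_def[symmetric] A_def[symmetric] B_def[symmetric] e_def[symmetric]
      C_def[symmetric] ..
  have r: "exits d (Suc n) v R \<delta>' = {u \<in> A \<union> C. v \<notin> \<delta>' u}"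
    unfolding exits.simps Let_def c_def[symmetric] A' B' C' ..
  show ?case unfolding l r using sub subC Suc.prems by auto
qed simp

text \<open>
  If a set \<open>V\<close> contains with each of its frogs all vertices that the ray of this frog enters, then
  the exploration never leaves \<open>V\<close>. It is applied to the activated frogs.
\<close>

lemma exits_awake:
  assumes d: "d > 0"
    and desc: "\<And>u w. u \<in> V \<Longrightarrow> length u < N \<Longrightarrow> w \<in> \<delta> u \<Longrightarrow> length w < N \<Longrightarrow> \<exists>i<d. i # w \<in> \<delta> u"
    and visit: "\<And>u w. u \<in> V \<Longrightarrow> length u < N \<Longrightarrow> w \<in> \<delta> u \<Longrightarrow> \<not> suffix w u \<Longrightarrow> w \<in> V"
    and "length v + n \<le> N" "v \<in> R" "v \<in> V"
    and "\<And>w. w \<in> R \<Longrightarrow> length w < N \<Longrightarrow> \<exists>i<d. i # w \<in> R"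
    and "\<And>w. w \<in> R \<Longrightarrow> suffix v w \<Longrightarrow> w \<in> V"
  shows "exits d n v R \<delta> \<subseteq> V"
  using assms(4-)
proof (induction n arbitrary: v R)
  case (Suc n)
  define c A where "c = child d {} v R" and "A = insert v (exits d n (c # v) R \<delta>)"
  define B where "B = {u \<in> A. crosses d {c} v (\<delta> u)}"
  define e where "e = \<delta> (SOME u. u \<in> B)"
  define C where "C = (if B = {} then {} else exits d n (child d {c} v e # v) e \<delta>)"
  have "crosses d {} v R" using Suc.prems(1,2,4) by (auto simp: crosses_def)
  then have c: "c < d" "c # v \<in> R" using child_props by (auto simp: c_def)
  have "exits d n (c # v) R \<delta> \<subseteq> V"
  proof (rule Suc.IH)
    show "c # v \<in> V" using Suc.prems(5)[OF c(2)] by (simp add: suffix_Cons)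
    show "w \<in> V" if "w \<in> R" "suffix (c # v) w" for w
      using Suc.prems(5)[OF that(1)] that(2) by (meson suffix_ConsD)
  qed (use Suc.prems c in auto)
  then have A: "A \<subseteq> V" using Suc.prems(3) by (simp add: A_def)
  have Asub: "u = v \<or> suffix (c # v) u" "length u < N" if "u \<in> A" for u
    using that exits_subset[OF d, of n "c # v" R \<delta>] subtree_suffix[of u d n "c # v"]
      subtree_length[of u d n "c # v"] Suc.prems(1) by (auto simp: A_def)
  have "C \<subseteq> V"
  proof (cases "B = {}")
    case False
    then have "(SOME u. u \<in> B) \<in> B" by (simp add: some_in_eq)
    then obtain u where u: "u \<in> A" "crosses d {c} v e" "e = \<delta> u" unfolding e_def B_def by blast
    define c' where "c' = child d {c} v e"
    have c': "c' < d" "c' \<noteq> c" "c' # v \<in> e" using child_props[OF u(2)] by (auto simp: c'_def)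
    have off: "\<not> suffix w u" if "suffix (c' # v) w" for w
    proof
      assume "suffix w u"
      then have "suffix (c' # v) u" using that by (meson suffix_order.trans)
      moreover have "\<not> suffix (c' # v) v" by (auto dest: suffix_length_le)
      ultimately have "suffix (c' # v) u" "suffix (c # v) u" using Asub(1)[OF u(1)] by auto
      then have "c' = c" by (rule child_unique)
      then show False using c'(2) by simp
    qed
    have uV: "u \<in> V" "length u < N" using u A Asub by auto
    have inV: "w \<in> V" if "w \<in> e" "suffix (c' # v) w" for w
      using visit[OF uV] that off u(3) by blast
    have "exits d n (c' # v) e \<delta> \<subseteq> V"
      using Suc.prems(1) c' inV desc[OF uV] u(3) by (intro Suc.IH) auto
    then show ?thesis using False by (simp add: C_def c'_def)
  qed (simp add: C_def)
  moreover have "exits d (Suc n) v R \<delta> = {u \<in> A \<union> C. v \<notin> \<delta> u}"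
    unfolding exits.simps Let_def c_def[symmetric] A_def[symmetric] B_def[symmetric] e_def[symmetric]
      C_def[symmetric] ..
  ultimately show ?case using A by auto
qed simp

section \<open>The generating function of the number of exits\<close>

lemma finite_set_Pi_pmf:
  assumes "finite A" "\<And>x. finite (set_pmf (p x))"
  shows "finite (set_pmf (Pi_pmf A dflt p))"
  using assms by (simp add: set_Pi_pmf finite_PiE_dflt)

lemma expectation_Pi_pmf_Un:
  fixes F :: "('a \<Rightarrow> 'b) \<Rightarrow> real"
  assumes "finite A" "finite B" "A \<inter> B = {}" "\<And>x. finite (set_pmf (p x))"
  shows "measure_pmf.expectation (Pi_pmf (A \<union> B) dflt p) F =
    measure_pmf.expectation (Pi_pmf A dflt p) (\<lambda>f. measure_pmf.expectation (Pi_pmf B dflt p)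
      (\<lambda>g. F (\<lambda>x. if x \<in> A then f x else g x)))"
  using assms by (simp add: Pi_pmf_union expectation_pair_pmf finite_set_Pi_pmf case_prod_unfold cong: if_cong)

text \<open>
  The value \<open>s\<close> stands for the generating function at \<open>x / 2\<close>, where every frog returning from the first child has
  to leave the subtree of \<open>v\<close>, and \<open>t\<close> for its value at \<open>(1 + x) / 2\<close>, where it may also end below a sibling.
  With probability \<open>(1 - h) / d\<close> the frog of \<open>v\<close> ends below the first child.
\<close>

definition exit_step :: "nat \<Rightarrow> real \<Rightarrow> real \<Rightarrow> real \<Rightarrow> real" where
  "exit_step d x s t =
     (up_prob d * x + (1 - up_prob d) / real d) * s * (1 - t)
      + (1 - up_prob d + up_prob d * x) * t * t"

primrec exit_gf :: "nat \<Rightarrow> nat \<Rightarrow> real \<Rightarrow> real" where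
  "exit_gf d 0 x = 1"
| "exit_gf d (Suc n) x = exit_step d x (exit_gf d n (x / 2)) (exit_gf d n ((1 + x) / 2))"

text \<open>
  The properties of the laws \<open>q u\<close> of the rays, truncated at level \<open>N\<close>, on which the recursion rests.
  The root is exempt from the two laws, because its frog is only used to enter the tree.
\<close>

locale end_laws =
  fixes d N :: nat and q :: "vertex \<Rightarrow> vertex set pmf"
  assumes d2: "d \<ge> 2"
    and finite_q: "\<And>u. finite (set_pmf (q u))"
    and closed: "\<And>u e i w. e \<in> set_pmf (q u) \<Longrightarrow> i # w \<in> e \<Longrightarrow> w \<in> e"
    and descend: "\<And>u e w. u \<in> vertices d \<Longrightarrow> e \<in> set_pmf (q u) \<Longrightarrow> w \<in> e \<Longrightarrow> length w < N \<Longrightarrow> \<exists>i<d. i # w \<in> e"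
    and unique: "\<And>u e i j w. e \<in> set_pmf (q u) \<Longrightarrow> i # w \<in> e \<Longrightarrow> j # w \<in> e \<Longrightarrow> i = j"
    and exit_prob: "\<And>u w. u \<in> vertices d \<Longrightarrow> u \<noteq> [] \<Longrightarrow> suffix w u \<Longrightarrow> length w \<le> N \<Longrightarrow>
      measure (q u) {e. w \<notin> e} = up_prob d * (1 / 2) ^ (length u - length w)"
    and child_prob: "\<And>u i. u \<in> vertices d \<Longrightarrow> u \<noteq> [] \<Longrightarrow> i < d \<Longrightarrow> length u < N \<Longrightarrow>
      measure (q u) {e. i # u \<in> e} = (1 - up_prob d) / d"
begin

lemma integrable_q [simp]: "integrable (measure_pmf (q u)) (f :: _ \<Rightarrow> real)"
  by (rule integrable_measure_pmf_finite[OF finite_q])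

lemma expectation_q_cong:
  "(\<And>e. e \<in> set_pmf (q u) \<Longrightarrow> f e = g e) \<Longrightarrow>
    measure_pmf.expectation (q u) f = measure_pmf.expectation (q u) (g :: _ \<Rightarrow> real)"
  by (intro integral_cong_AE) (auto simp: AE_measure_pmf_iff)

lemma expectation_q_of_bool:
  "measure_pmf.expectation (q u) (\<lambda>e. of_bool (P e)) = measure (q u) {e. P e}"
proof -
  have "(\<lambda>e. of_bool (P e) :: real) = indicator {e. P e}" by (auto simp: fun_eq_iff)
  then show ?thesis by simp
qed

text \<open>
  Weighting the frogs by arbitrary functions \<open>\<phi>\<close> of their rays makes the induction work: what
  matters about \<open>\<phi>\<close> is its conditional mean \<open>x\<close> on the event of leaving the subtree, which does not
  depend on the starting point of the frog.
  
  For the step, \<open>\<phi>1\<close> is the weight that vanishes on frogs that end below another child than \<open>c\<close>. It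
  detects that the second child subtree stays closed, and from the point of view of \<open>c\<close> its conditional
  mean is \<open>x / 2\<close>. The weight \<open>\<phi>2\<close> counts only the frogs that leave the subtree of \<open>v\<close>. Its conditional
  mean is \<open>(1 + x) / 2\<close>, for \<open>c\<close> as well as for the second child, whichever this is. If \<open>P \<phi>\<close> denotes
  the product of \<open>\<phi>\<close> over the frogs at \<open>v\<close>, the weight of the exits is \<open>P \<phi>1 + (P \<phi>2 - P \<phi>1) Q\<close>, where
  \<open>Q\<close> is the contribution of the second child subtree.
\<close>

lemma expectation_exits:
  assumes "v \<in> vertices d" "v \<noteq> []" "length v + n \<le> N" "finite F" "subtree d n v \<subseteq> F"
    and "\<And>u. u \<in> subtree d n v \<Longrightarrow> measure_pmf.expectation (q u) (\<lambda>e. \<phi> u e * of_bool (v \<notin> e))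
      = x * (up_prob d * (1 / 2) ^ (length u - length v))"
  shows "measure_pmf.expectation (Pi_pmf F {} q) (\<lambda>\<delta>. \<Prod>u\<in>exits d n v R \<delta>. \<phi> u (\<delta> u)) = exit_gf d n x"
  using assms
proof (induction n arbitrary: v R F \<phi> x)
  case (Suc n)
  have d0: "d > 0" using d2 by simp
  define c where "c = child d {} v R"
  define T A B where "T = subtree d n (c # v)" and "A = insert v T" and "B = F - A"
  define \<phi>1 where "\<phi>1 u e = (if v \<notin> e then \<phi> u e else if crosses d {c} v e then 0 else 1)" for u e
  define \<phi>2 where "\<phi>2 u e = (if v \<notin> e then \<phi> u e else 1)" for u e
  define h where "h = up_prob d"
  note hyp = Suc.prems(6)
  have c: "c < d" using child_less[OF d0] by (simp add: c_def)
  have vN: "length v < N" using Suc.prems(3) by simp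
  have fin: "finite T" "finite A" "finite B" using Suc.prems(4) by (auto simp: T_def A_def B_def)
  have AF: "A \<subseteq> F" using Suc.prems(5) subtree_child[OF c] subtree_self[of v d n] by (auto simp: A_def T_def)
  have vT: "v \<notin> T" unfolding T_def by (rule subtree_child_not_self)
  have vert: "u \<in> vertices d" "u \<noteq> []" if "u \<in> subtree d (Suc n) v" for u
    using subtree_vertices[OF Suc.prems(1) that] subtree_length[OF that] Suc.prems(2) by auto
  have child_vert: "i # v \<in> vertices d" if "i < d" for i
    using Suc.prems(1) that by (auto simp: vertices_def)
  have in_child: "\<exists>i<d. i # v \<in> e" if "e \<in> set_pmf (q u)" "u \<in> subtree d (Suc n) v" "v \<in> e" for e u
    using descend[OF vert(1)[OF that(2)] that(1,3) vN] .

  have two: "measure_pmf.expectation (q u) (\<lambda>e. \<phi>2 u e * of_bool (i # v \<notin> e))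
      = (1 + x) / 2 * (up_prob d * (1 / 2) ^ (length u - length (i # v)))"
    if i: "i < d" and u: "u \<in> subtree d n (i # v)" for i u
  proof -
    have u': "u \<in> subtree d (Suc n) v" using u subtree_child[OF i] by blast
    have lu: "length u - length v = Suc (length u - length (i # v))"
      using subtree_length[OF u] by (simp add: Suc_diff_Suc)
    have "measure_pmf.expectation (q u) (\<lambda>e. \<phi>2 u e * of_bool (i # v \<notin> e)) =
        measure_pmf.expectation (q u) (\<lambda>e. \<phi> u e * of_bool (v \<notin> e) + of_bool (i # v \<notin> e) - of_bool (v \<notin> e))"
      using closed by (intro expectation_q_cong) (auto simp: \<phi>2_def)
    also have "\<dots> = x * (h * (1/2) ^ (length u - length v)) + measure (q u) {e. i # v \<notin> e} - measure (q u) {e. v \<notin> e}"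
      by (simp add: hyp[OF u'] expectation_q_of_bool h_def)
    also have "measure (q u) {e. i # v \<notin> e} = h * (1/2) ^ (length u - length (i # v))"
      unfolding h_def using vert[OF u'] subtree_suffix[OF u] vN by (intro exit_prob) auto
    also have "measure (q u) {e. v \<notin> e} = h * (1/2) ^ (length u - length v)"
      unfolding h_def using vert[OF u'] subtree_suffix[OF u'] vN by (intro exit_prob) auto
    finally show ?thesis unfolding lu by (simp add: h_def algebra_simps)
  qed
  have one: "measure_pmf.expectation (q u) (\<lambda>e. \<phi>1 u e * of_bool (c # v \<notin> e))
      = x / 2 * (up_prob d * (1 / 2) ^ (length u - length (c # v)))" if u: "u \<in> T" for u
  proof -
    have u': "u \<in> subtree d (Suc n) v" using u subtree_child[OF c] by (auto simp: T_def)
    have lu: "length u - length v = Suc (length u - length (c # v))"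
      using subtree_length[of u d n "c # v"] u by (simp add: T_def Suc_diff_Suc)
    have "measure_pmf.expectation (q u) (\<lambda>e. \<phi>1 u e * of_bool (c # v \<notin> e)) =
        measure_pmf.expectation (q u) (\<lambda>e. \<phi> u e * of_bool (v \<notin> e))"
    proof (rule expectation_q_cong)
      fix e assume e: "e \<in> set_pmf (q u)"
      show "\<phi>1 u e * of_bool (c # v \<notin> e) = \<phi> u e * of_bool (v \<notin> e)"
        using in_child[OF e u'] closed[OF e] by (auto simp: \<phi>1_def crosses_def)
    qed
    then show ?thesis using hyp[OF u'] lu by simp
  qed
  have own_exit: "measure (q v) {e. v \<notin> e} = h"
    using exit_prob[of v v] Suc.prems(1,2) vN by (simp add: h_def)
  have own: "measure_pmf.expectation (q v) (\<lambda>e. \<phi> v e * of_bool (v \<notin> e)) = x * h"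
    using hyp[OF subtree_self] by (simp add: h_def)
  \<comment> \<open>The frog of \<open>v\<close> survives the weight \<open>\<phi>1\<close> if it leaves or ends below \<open>c\<close>.\<close>
  have own1: "measure_pmf.expectation (q v) (\<phi>1 v) = h * x + (1 - h) / real d"
  proof -
    have "measure_pmf.expectation (q v) (\<phi>1 v) =
        measure_pmf.expectation (q v) (\<lambda>e. \<phi> v e * of_bool (v \<notin> e) + of_bool (c # v \<in> e))"
    proof (rule expectation_q_cong)
      fix e assume e: "e \<in> set_pmf (q v)"
      show "\<phi>1 v e = \<phi> v e * of_bool (v \<notin> e) + of_bool (c # v \<in> e)"
        using in_child[OF e subtree_self] closed[OF e] unique[OF e] c by (auto simp: \<phi>1_def crosses_def)
    qed
    also have "\<dots> = h * x + (1 - h) / real d"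
      using child_prob[OF Suc.prems(1,2) c vN] own by (simp add: expectation_q_of_bool h_def)
    finally show ?thesis .
  qed
  have own2: "measure_pmf.expectation (q v) (\<phi>2 v) = 1 - h + h * x"
  proof -
    have "measure_pmf.expectation (q v) (\<phi>2 v) =
        measure_pmf.expectation (q v) (\<lambda>e. \<phi> v e * of_bool (v \<notin> e) + (1 - of_bool (v \<notin> e)))"
      by (intro expectation_q_cong) (auto simp: \<phi>2_def)
    also have "\<dots> = 1 - h + h * x"
      using own own_exit by (simp add: expectation_q_of_bool)
    finally show ?thesis .
  qed

  define P where "P \<psi> f = (\<Prod>u\<in>insert v (exits d n (c # v) R f). \<psi> u (f u))"
    for \<psi> :: "vertex \<Rightarrow> vertex set \<Rightarrow> real" and f
  have S1T: "exits d n (c # v) R f \<subseteq> T" for f unfolding T_def by (rule exits_subset[OF d0])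
  have finS1: "finite (exits d n (c # v) R f)" for f using S1T fin(1) by (rule finite_subset)
  have P_split: "P \<psi> f = \<psi> v (f v) * (\<Prod>u\<in>exits d n (c # v) R f. \<psi> u (f u))" for \<psi> f
    unfolding P_def using S1T[of f] vT finS1 by (subst prod.insert) auto
  have E_P: "measure_pmf.expectation (Pi_pmf A {} q) (P \<psi>) = measure_pmf.expectation (q v) (\<psi> v) *
      measure_pmf.expectation (Pi_pmf T {} q) (\<lambda>f. \<Prod>u\<in>exits d n (c # v) R f. \<psi> u (f u))" for \<psi>
  proof -
    have eq: "P \<psi> (\<lambda>u. if u \<in> {v} then f u else g u) =
        \<psi> v (f v) * (\<Prod>u\<in>exits d n (c # v) R g. \<psi> u (g u))" for f g
    proof -
      have "exits d n (c # v) R (\<lambda>u. if u \<in> {v} then f u else g u) = exits d n (c # v) R g"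
        using vT by (intro exits_cong d0) (auto simp: T_def)
      then show ?thesis
        using S1T[of g] vT by (auto simp: P_split intro!: prod.cong arg_cong2[where f = "(*)"])
    qed
    have "measure_pmf.expectation (Pi_pmf A {} q) (P \<psi>) =
        measure_pmf.expectation (Pi_pmf {v} {} q) (\<lambda>f. \<psi> v (f v)) *
        measure_pmf.expectation (Pi_pmf T {} q) (\<lambda>f. \<Prod>u\<in>exits d n (c # v) R f. \<psi> u (f u))"
      using expectation_Pi_pmf_Un[of "{v}" T q "{}" "P \<psi>"] vT fin(1) finite_q unfolding eq
      by (simp add: A_def)
    then show ?thesis by (simp add: Pi_pmf_singleton)
  qed
  have E_P1: "measure_pmf.expectation (Pi_pmf A {} q) (P \<phi>1) = (h * x + (1 - h) / real d) * exit_gf d n (x / 2)"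
    unfolding E_P own1 using Suc.prems(3) child_vert[OF c] fin one
    by (subst Suc.IH[of "c # v" T \<phi>1 "x / 2"]) (auto simp: T_def)
  have E_P2: "measure_pmf.expectation (Pi_pmf A {} q) (P \<phi>2) = (1 - h + h * x) * exit_gf d n ((1 + x) / 2)"
    unfolding E_P own2 using Suc.prems(3) child_vert[OF c] fin two[OF c]
    by (subst Suc.IH[of "c # v" T \<phi>2 "(1 + x) / 2"]) (auto simp: T_def)

  define K where "K f = {u \<in> insert v (exits d n (c # v) R f). crosses d {c} v (f u)}" for f
  define en where "en f = f (SOME u. u \<in> K f)" for f
  define c' where "c' f = child d {c} v (en f)" for f
  define Q where "Q f g = (\<Prod>u\<in>exits d n (c' f # v) (en f) g. \<phi>2 u (g u))" for f g
  have K_en: "crosses d {c} v (en f)" if "K f \<noteq> {}" for f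
  proof -
    have "(SOME u. u \<in> K f) \<in> K f" using that by (simp add: some_in_eq)
    then show ?thesis unfolding en_def by (simp add: K_def)
  qed
  have c'_props: "c' f < d" "c' f \<noteq> c" if "K f \<noteq> {}" for f
    using child_props[OF K_en[OF that]] by (auto simp: c'_def)
  have c'_B: "subtree d n (c' f # v) \<subseteq> B" if "K f \<noteq> {}" for f
  proof
    fix u assume u: "u \<in> subtree d n (c' f # v)"
    then have "u \<notin> T"
      using subtree_children_disjoint[OF u, of n c] c'_props(2)[OF that] unfolding T_def by auto
    moreover have "u \<noteq> v" using u subtree_child_not_self by metis
    moreover have "u \<in> F" using u subtree_child c'_props[OF that] Suc.prems(5) by blast
    ultimately show "u \<in> B" by (simp add: A_def B_def)
  qed

  have decomp: "(\<Prod>u\<in>exits d (Suc n) v R (\<lambda>u. if u \<in> A then f u else g u). \<phi> u (if u \<in> A then f u else g u)) =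
      P \<phi>1 f + (P \<phi>2 f - P \<phi>1 f) * Q f g" if f: "f \<in> set_pmf (Pi_pmf A {} q)" for f g
  proof -
    define \<delta> where "\<delta> = (\<lambda>u. if u \<in> A then f u else g u)"
    have \<delta>A: "\<delta> u = f u" if "u \<in> A" for u using that by (simp add: \<delta>_def)
    have supp: "f u \<in> set_pmf (q u)" if "u \<in> A" for u
      using f that fin by (auto simp: set_Pi_pmf PiE_dflt_def)
    have S1: "exits d n (c # v) R \<delta> = exits d n (c # v) R f"
      by (intro exits_cong d0 \<delta>A) (simp add: A_def T_def)
    define A1 where "A1 = insert v (exits d n (c # v) R f)"
    have A1A: "A1 \<subseteq> A" using S1T[of f] by (auto simp: A1_def A_def)
    have finA1: "finite A1" using finS1 by (simp add: A1_def)
    have K: "{u \<in> A1. crosses d {c} v (\<delta> u)} = K f"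
      using A1A \<delta>A by (auto simp: K_def A1_def[symmetric])
    have en: "\<delta> (SOME u. u \<in> K f) = en f" if "K f \<noteq> {}"
    proof -
      have "(SOME u. u \<in> K f) \<in> K f" using that by (simp add: some_in_eq)
      then have "(SOME u. u \<in> K f) \<in> A" using A1A by (auto simp: K_def A1_def)
      then show ?thesis by (simp add: en_def \<delta>A)
    qed
    define C where "C = (if K f = {} then {} else exits d n (c' f # v) (en f) \<delta>)"
    have C_alt: "C = (if K f = {} then {} else
        exits d n (child d {c} v (\<delta> (SOME u. u \<in> K f)) # v) (\<delta> (SOME u. u \<in> K f)) \<delta>)"
      using en by (simp add: C_def c'_def)
    have ex: "exits d (Suc n) v R \<delta> = {u \<in> A1 \<union> C. v \<notin> \<delta> u}"
      unfolding exits.simps Let_def c_def[symmetric] S1 A1_def[symmetric] K C_alt ..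
    have CB: "C \<subseteq> B"
      using exits_subset[OF d0, of n "c' f # v" "en f" \<delta>] c'_B by (auto simp: C_def)
    have finC: "finite C" using CB fin(3) by (rule finite_subset)
    have disj: "A1 \<inter> C = {}" using A1A CB by (auto simp: B_def)
    have "(\<Prod>u\<in>exits d (Suc n) v R \<delta>. \<phi> u (\<delta> u)) = (\<Prod>u\<in>A1 \<union> C. \<phi>2 u (\<delta> u))"
      unfolding ex using finA1 finC by (intro prod.mono_neutral_cong_left) (auto simp: \<phi>2_def)
    also have "\<dots> = (\<Prod>u\<in>A1. \<phi>2 u (\<delta> u)) * (\<Prod>u\<in>C. \<phi>2 u (\<delta> u))"
      using finA1 finC disj by (rule prod.union_disjoint)
    also have "(\<Prod>u\<in>A1. \<phi>2 u (\<delta> u)) = P \<phi>2 f"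
      unfolding P_def A1_def[symmetric] using A1A \<delta>A by (intro prod.cong) auto
    finally have X: "(\<Prod>u\<in>exits d (Suc n) v R \<delta>. \<phi> u (\<delta> u)) = P \<phi>2 f * (\<Prod>u\<in>C. \<phi>2 u (\<delta> u))" .
    show ?thesis
    proof (cases "K f = {}")
      case True
      have "P \<phi>2 f = P \<phi>1 f"
        unfolding P_def using True by (intro prod.cong) (auto simp: K_def \<phi>1_def \<phi>2_def)
      then show ?thesis using X True unfolding \<delta>_def C_def by simp
    next
      case False
      have "C = exits d n (c' f # v) (en f) g"
        using False c'_B[OF False] by (auto simp: C_def \<delta>_def B_def intro!: exits_cong d0)
      moreover have "\<delta> u = g u" if "u \<in> C" for u using that CB by (auto simp: \<delta>_def B_def)
      ultimately have "(\<Prod>u\<in>C. \<phi>2 u (\<delta> u)) = Q f g" by (auto simp: Q_def intro!: prod.cong)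
      moreover have "P \<phi>1 f = 0"
      proof -
        obtain u where u: "u \<in> A1" "crosses d {c} v (f u)" using False by (auto simp: K_def A1_def)
        then obtain i where "i # v \<in> f u" by (auto simp: crosses_def)
        then have "v \<in> f u" using closed supp u(1) A1A by blast
        then have "\<phi>1 u (f u) = 0" using u(2) by (simp add: \<phi>1_def)
        then show ?thesis unfolding P_def A1_def[symmetric] using finA1 u(1) by (intro prod_zero) auto
      qed
      ultimately show ?thesis using X unfolding \<delta>_def by simp
    qed
  qed
  \<comment> \<open>If no frog enters a second child, both sides vanish. Otherwise the induction hypothesis
      applies with the ray of the entering frog held fixed.\<close>
  have EQ: "(P \<phi>2 f - P \<phi>1 f) * measure_pmf.expectation (Pi_pmf B {} q) (Q f) =
      (P \<phi>2 f - P \<phi>1 f) * exit_gf d n ((1 + x) / 2)" for f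
  proof (cases "K f = {}")
    case True
    have "P \<phi>2 f = P \<phi>1 f"
      unfolding P_def using True by (intro prod.cong) (auto simp: K_def \<phi>1_def \<phi>2_def)
    then show ?thesis by simp
  next
    case False
    have "measure_pmf.expectation (Pi_pmf B {} q) (Q f) = exit_gf d n ((1 + x) / 2)"
      unfolding Q_def using Suc.prems(3) child_vert c'_props[OF False] fin(3) c'_B[OF False] two
      by (intro Suc.IH) auto
    then show ?thesis by simp
  qed
  have int: "integrable (measure_pmf (Pi_pmf X {} q)) G" if "finite X" for X and G :: "(vertex \<Rightarrow> vertex set) \<Rightarrow> real"
    by (intro integrable_measure_pmf_finite finite_set_Pi_pmf that finite_q)
  have FAB: "F = A \<union> B" using AF by (auto simp: B_def)
  have "measure_pmf.expectation (Pi_pmf F {} q) (\<lambda>\<delta>. \<Prod>u\<in>exits d (Suc n) v R \<delta>. \<phi> u (\<delta> u)) =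
      measure_pmf.expectation (Pi_pmf A {} q) (\<lambda>f. measure_pmf.expectation (Pi_pmf B {} q)
        (\<lambda>g. \<Prod>u\<in>exits d (Suc n) v R (\<lambda>u. if u \<in> A then f u else g u). \<phi> u (if u \<in> A then f u else g u)))"
    unfolding FAB using fin finite_q by (subst expectation_Pi_pmf_Un) (auto simp: B_def)
  also have "\<dots> = measure_pmf.expectation (Pi_pmf A {} q)
      (\<lambda>f. P \<phi>1 f + (P \<phi>2 f - P \<phi>1 f) * exit_gf d n ((1 + x) / 2))"
  proof (intro integral_cong_AE)
    show "AE f in Pi_pmf A {} q. measure_pmf.expectation (Pi_pmf B {} q)
        (\<lambda>g. \<Prod>u\<in>exits d (Suc n) v R (\<lambda>u. if u \<in> A then f u else g u). \<phi> u (if u \<in> A then f u else g u)) =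
        P \<phi>1 f + (P \<phi>2 f - P \<phi>1 f) * exit_gf d n ((1 + x) / 2)"
      unfolding AE_measure_pmf_iff
    proof
      fix f assume f: "f \<in> set_pmf (Pi_pmf A {} q)"
      show "measure_pmf.expectation (Pi_pmf B {} q)
        (\<lambda>g. \<Prod>u\<in>exits d (Suc n) v R (\<lambda>u. if u \<in> A then f u else g u). \<phi> u (if u \<in> A then f u else g u)) =
        P \<phi>1 f + (P \<phi>2 f - P \<phi>1 f) * exit_gf d n ((1 + x) / 2)"
        unfolding decomp[OF f] EQ[symmetric] using int[OF fin(3)] by simp
    qed
  qed simp_all
  also have "\<dots> = measure_pmf.expectation (Pi_pmf A {} q) (P \<phi>1) +
      (measure_pmf.expectation (Pi_pmf A {} q) (P \<phi>2) - measure_pmf.expectation (Pi_pmf A {} q) (P \<phi>1))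
        * exit_gf d n ((1 + x) / 2)"
    using int[OF fin(2)] by simp
  also have "\<dots> = exit_gf d (Suc n) x"
    unfolding E_P1 E_P2 by (simp add: exit_step_def h_def algebra_simps diff_divide_distrib add_divide_distrib)
  finally show ?case .
qed simp

end

section \<open>Comparison with Poisson variables\<close>

text \<open>
  Monotonicity in \<open>t\<close> holds only on the region \<open>s \<le> t\<close>, where the negative term is dominated
  by the square. Generating functions stay in this region because they are increasing.
\<close>

lemma exit_step_mono:
  assumes "d \<ge> 2" "0 \<le> x" "x \<le> x'" "0 \<le> s" "s \<le> t" "s \<le> s'" "t \<le> t'" "t' \<le> 1"
  shows "exit_step d x s t \<le> exit_step d x' s' t'"
proof -
  define h c where "h = up_prob d" and "c = (1 - up_prob d) / real d"
  have h: "0 < h" "h < 1/2" and c: "0 \<le> c" "c \<le> h"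
    using assms(1) up_prob_bounds[of d] same_child_le_up_prob[of d] by (auto simp: h_def c_def)
  have step_eq: "exit_step d x s t = (h * x + c) * s * (1 - t) + (1 - h + h * x) * t * t" for x s t
    by (simp add: exit_step_def h_def c_def)
  have "exit_step d x s t \<le> exit_step d x s t'"
  proof -
    have "(h * x + c) * s \<le> (1 - h + h * x) * (t + t')"
    proof (rule mult_mono)
      show "h * x + c \<le> 1 - h + h * x" using h c by simp
      show "s \<le> t + t'" using assms by simp
      show "0 \<le> 1 - h + h * x" using h assms by simp
    qed (use assms in auto)
    then have "0 \<le> (t' - t) * ((1 - h + h * x) * (t + t') - (h * x + c) * s)"
      using assms by simp
    then show ?thesis unfolding step_eq by (simp add: algebra_simps)
  qed
  also have "\<dots> \<le> exit_step d x s' t'"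
  proof -
    have "(h * x + c) * s * (1 - t') \<le> (h * x + c) * s' * (1 - t')"
      using assms h c by (intro mult_right_mono mult_left_mono) auto
    then show ?thesis by (simp add: step_eq)
  qed
  also have "\<dots> \<le> exit_step d x' s' t'"
    unfolding step_eq
    using assms h c by (intro add_mono mult_right_mono mult_left_mono) auto
  finally show ?thesis .
qed

lemma exit_gf_bounds:
  assumes "d \<ge> 2" "0 \<le> x" "x \<le> y" "y \<le> 1"
  shows "0 \<le> exit_gf d n x \<and> exit_gf d n x \<le> exit_gf d n y \<and> exit_gf d n y \<le> 1"
  using assms(2-)
proof (induction n arbitrary: x y)
  case (Suc n)
  note IH = Suc.IH
  have a: "exit_gf d n (x/2) \<le> exit_gf d n ((1+x)/2)" "0 \<le> exit_gf d n (x/2)"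
      "exit_gf d n ((1+x)/2) \<le> 1"
    using IH[of "x/2" "(1+x)/2"] Suc.prems by auto
  have b: "exit_gf d n (x/2) \<le> exit_gf d n (y/2)"
      "exit_gf d n ((1+x)/2) \<le> exit_gf d n ((1+y)/2)" "exit_gf d n ((1+y)/2) \<le> 1"
    using IH[of "x/2" "y/2"] IH[of "(1+x)/2" "(1+y)/2"] Suc.prems by auto
  have e: "exit_gf d n (y/2) \<le> exit_gf d n ((1+y)/2)" "0 \<le> exit_gf d n (y/2)"
    using IH[of "y/2" "(1+y)/2"] Suc.prems by auto
  have "exit_gf d (Suc n) y \<le> exit_step d 1 1 1"
    unfolding exit_gf.simps using assms(1) Suc.prems b e by (intro exit_step_mono) auto
  moreover have "exit_step d 0 0 0 \<le> exit_gf d (Suc n) x"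
    unfolding exit_gf.simps using assms(1) Suc.prems a by (intro exit_step_mono) auto
  ultimately show ?case
    using assms(1) Suc.prems a b
    by (auto simp: exit_step_def intro!: exit_step_mono[unfolded exit_step_def])
qed simp

text \<open>
  Without the term \<open>exp (- t) / 8\<close> there is a short argument with \<open>r = t - 1\<close>: bound \<open>1 + x\<close> by \<open>exp x\<close>, use
  \<open>exp (- r x) \<le> 1 - x + x exp (- r)\<close> by convexity, and \<open>exp (x - 1) \<ge> x\<close>. The strict
  version keeps the quadratic remainders of the first and of the last bound, which together
  contribute at least \<open>exp (- t) (1 - x) (t x\<^sup>2 + 1 - x) / 2\<close>. The last factor is at least \<open>1/4\<close> once \<open>t \<ge> 1/3\<close>. For
  smaller \<open>t\<close> the left-hand side is at most \<open>2 t (1 - x)\<close>.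
\<close>

lemma exp_gap:
  fixes t x :: real
  assumes "0 \<le> t" "0 \<le> x" "x \<le> 1"
  shows "(1 + x) * (exp (- t * x) - exp (- t)) \<le> (1 - exp (- t) / 8) * (1 - x)"
proof (cases "t \<le> 1/3")
  case True
  have "1 - t * (1 - x) \<le> exp (- (t * (1 - x)))"
    using exp_ge_add_one_self[of "- (t * (1 - x))"] by simp
  then have "exp (- t * x) * (1 - t * (1 - x)) \<le> exp (- t * x) * exp (- (t * (1 - x)))"
    by (intro mult_left_mono) auto
  also have "\<dots> = exp (- t)" by (simp add: exp_add[symmetric] algebra_simps)
  finally have "exp (- t * x) - exp (- t) \<le> exp (- t * x) * (t * (1 - x))"
    by (simp add: algebra_simps)
  also have "\<dots> \<le> 1 * (1/3 * (1 - x))"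
    using assms True by (intro mult_mono) auto
  finally have "(1 + x) * (exp (- t * x) - exp (- t)) \<le> 2 * (1/3 * (1 - x))"
    using assms by (intro mult_mono) (auto simp: mult_left_le)
  also have "\<dots> \<le> (1 - exp (- t) / 8) * (1 - x)"
  proof -
    have "exp (- t) \<le> 1" using assms by simp
    then have "2/3 \<le> 1 - exp (- t) / 8" by linarith
    then have "(2/3) * (1 - x) \<le> (1 - exp (- t) / 8) * (1 - x)"
      using assms by (intro mult_right_mono) auto
    then show ?thesis by simp
  qed
  finally show ?thesis .
next
  case False
  define E where "E = exp (- t)"
  have E: "0 < E" by (simp add: E_def)
  have conv: "exp (- (t - 1) * x) \<le> 1 - x + x * exp (- (t - 1))"
  proof -
    have "exp ((1 - x) *\<^sub>R 0 + x *\<^sub>R (- (t - 1))) \<le> (1 - x) * exp 0 + x * exp (- (t - 1))"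
      using assms by (intro convex_onD[OF exp_convex]) auto
    then show ?thesis by (simp add: algebra_simps)
  qed
  have e1: "exp (x - 1) \<ge> x + (1 - x)\<^sup>2 / (2 * exp 1)"
  proof -
    have "1 + (x - 1) + (1 - x)\<^sup>2 / 2 * exp (-1) \<le> exp (x - 1)"
    proof -
      obtain u where u: "\<bar>u\<bar> \<le> \<bar>x - 1\<bar>"
          and eq: "exp (x - 1) = (\<Sum>m<2. (x - 1) ^ m / fact m) + exp u / fact 2 * (x - 1) ^ 2"
        using Maclaurin_exp_le[of "x - 1" 2] by blast
      have "exp (-1) \<le> exp u" using u assms by auto
      then have "(1 - x)\<^sup>2 / 2 * exp (-1) \<le> (1 - x)\<^sup>2 / 2 * exp u"
        by (intro mult_left_mono) auto
      then show ?thesis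
        unfolding eq by (simp add: numeral_2_eq_2 power2_eq_square algebra_simps)
    qed
    then show ?thesis by (simp add: exp_minus field_simps)
  qed
  have e2: "1 + x \<le> exp x - x\<^sup>2 / 2"
    using exp_lower_Taylor_quadratic[of x] assms by simp
  have diff: "E * (t * (1 - x)) \<le> exp (- t * x) - E"
  proof -
    have "E * (1 + t * (1 - x)) \<le> E * exp (t * (1 - x))"
      using E exp_ge_add_one_self[of "t * (1 - x)"] by (intro mult_left_mono) auto
    also have "\<dots> = exp (- t * x)" by (simp add: E_def exp_add[symmetric] algebra_simps)
    finally show ?thesis by (simp add: algebra_simps)
  qed
  have gap_nonneg: "0 \<le> exp (- t * x) - E"
    using diff E assms by (meson mult_nonneg_nonneg order_trans less_imp_le diff_ge_0_iff_ge)
  \<comment> \<open>The difference is \<open>(x - 3/2)\<^sup>2 / 3\<close> plus a multiple of \<open>t - 1/3\<close>.\<close>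
  have quad: "1 / 4 \<le> t * x\<^sup>2 + (1 - x)"
  proof -
    have "1 / 4 = 1 - x + 1 / 3 * x\<^sup>2 - (x - 3 / 2)\<^sup>2 / 3"
      by (simp add: power2_eq_square field_simps)
    also have "\<dots> \<le> 1 - x + t * x\<^sup>2 - 0"
      using False by (intro diff_mono add_left_mono mult_right_mono) auto
    finally show ?thesis by simp
  qed
  have "(1 + x) * (exp (- t * x) - E) \<le> (exp x - x\<^sup>2 / 2) * (exp (- t * x) - E)"
    using e2 gap_nonneg by (intro mult_right_mono) auto
  also have "\<dots> = exp x * (exp (- t * x) - E) - x\<^sup>2 / 2 * (exp (- t * x) - E)"
    by (simp add: algebra_simps)
  also have "\<dots> \<le> exp x * (exp (- t * x) - E) - x\<^sup>2 / 2 * (E * (t * (1 - x)))"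
    using diff by (intro diff_left_mono mult_left_mono) auto
  also have "exp x * (exp (- t * x) - E) = exp (- (t - 1) * x) - exp (- (t - 1)) * exp (x - 1)"
    by (simp add: E_def exp_add[symmetric] algebra_simps)
  also have "\<dots> \<le> 1 - x + x * exp (- (t - 1)) - exp (- (t - 1)) * (x + (1 - x)\<^sup>2 / (2 * exp 1))"
    using conv e1 by (intro diff_mono mult_left_mono) auto
  also have "\<dots> = 1 - x - E * (1 - x)\<^sup>2 / 2"
    by (simp add: E_def exp_diff exp_minus field_simps)
  also have "1 - x - E * (1 - x)\<^sup>2 / 2 - x\<^sup>2 / 2 * (E * (t * (1 - x)))
      = (1 - E / 2 * (t * x\<^sup>2 + (1 - x))) * (1 - x)"
    by (simp add: power2_eq_square field_simps)
  also have "\<dots> \<le> (1 - E / 2 * (1 / 4)) * (1 - x)"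
    using quad E assms by (intro mult_right_mono diff_left_mono mult_left_mono) auto
  finally show ?thesis by (simp add: E_def)
qed

text \<open>
  Dividing by \<open>exp (- a (1 - x))\<close> turns the claim into a bound for
  \<open>1 - h (1 - x) + (h x + (1 - h) / d) (exp (- t x) - exp (- t))\<close> with \<open>t = a / 2\<close>. As \<open>(1 - h) / d \<le> h\<close>, this
  is \<open>exp_gap\<close>.
\<close>

lemma exit_step_exp:
  assumes "d \<ge> 2" "0 \<le> a" "0 \<le> x" "x \<le> 1"
  shows "exit_step d x (exp (- a * (1 - x / 2))) (exp (- a * (1 - (1 + x) / 2)))
    \<le> exp (- (a + up_prob d * exp (- a / 2) / 8) * (1 - x))"
proof -
  define h c where "h = up_prob d" and "c = (1 - up_prob d) / real d"
  have h: "0 < h" "h < 1/2" and c: "0 \<le> c" "c \<le> h"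
    using assms(1) up_prob_bounds[of d] same_child_le_up_prob[of d] by (auto simp: h_def c_def)
  have step_eq: "exit_step d x s t = (h * x + c) * s * (1 - t) + (1 - h + h * x) * t * t" for x s t
    by (simp add: exit_step_def h_def c_def)
  define t where "t = a / 2"
  have a: "a = 2 * t" by (simp add: t_def)
  define K where "K = exp (- a * (1 - x))"
  have K: "0 < K" by (simp add: K_def)
  have tt: "exp (- a * (1 - (1 + x) / 2)) * exp (- a * (1 - (1 + x) / 2)) = K"
    by (simp add: K_def exp_add[symmetric] algebra_simps)
  have s: "exp (- a * (1 - x / 2)) = K * exp (- t * x)"
    by (simp add: K_def a exp_add[symmetric] algebra_simps)
  have s2: "exp (- t * x) * exp (- a * (1 - (1 + x) / 2)) = exp (- t)"
    by (simp add: a exp_add[symmetric] field_simps)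
  have "exit_step d x (exp (- a * (1 - x / 2))) (exp (- a * (1 - (1 + x) / 2)))
      = (h * x + c) * (K * (exp (- t * x) - exp (- t * x) * exp (- a * (1 - (1 + x) / 2))))
        + (1 - h + h * x) * (exp (- a * (1 - (1 + x) / 2)) * exp (- a * (1 - (1 + x) / 2)))"
    unfolding step_eq s by (simp add: algebra_simps)
  also have "\<dots> = K * ((h * x + c) * (exp (- t * x) - exp (- t)) + (1 - h * (1 - x)))"
    unfolding tt s2 by (simp add: algebra_simps)
  also have "\<dots> \<le> K * (h * ((1 + x) * (exp (- t * x) - exp (- t))) + (1 - h * (1 - x)))"
  proof -
    have "exp (- t) \<le> exp (- t * x)"
      using assms mult_left_le[of x t] by (simp add: a)
    moreover have "h * x + c \<le> h * (1 + x)" using c by (simp add: algebra_simps)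
    ultimately have "(h * x + c) * (exp (- t * x) - exp (- t)) \<le> (h * (1 + x)) * (exp (- t * x) - exp (- t))"
      by (intro mult_right_mono) auto
    then show ?thesis using K by (simp add: mult.assoc)
  qed
  also have "\<dots> \<le> K * (h * ((1 - exp (- t) / 8) * (1 - x)) + (1 - h * (1 - x)))"
    using exp_gap[of t x] assms K h by (intro mult_left_mono add_right_mono) (auto simp: a)
  also have "\<dots> = K * (1 + - (h * exp (- t) / 8 * (1 - x)))"
    by (simp add: algebra_simps)
  also have "\<dots> \<le> K * exp (- (h * exp (- t) / 8 * (1 - x)))"
    using K by (intro mult_left_mono exp_ge_add_one_self) auto
  also have "\<dots> = exp (- (a + up_prob d * exp (- a / 2) / 8) * (1 - x))"
    by (simp add: K_def exp_add[symmetric] h_def t_def algebra_simps)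
  finally show ?thesis .
qed

text \<open>
  The means of the Poisson variables used for comparison. The increments are bounded from below
  as long as the means are bounded, hence the means grow without bound.
\<close>

primrec exit_rate :: "nat \<Rightarrow> nat \<Rightarrow> real" where
  "exit_rate d 0 = 0"
| "exit_rate d (Suc n) = exit_rate d n + up_prob d * exp (- exit_rate d n / 2) / 8"

lemma exit_rate_nonneg: "d \<ge> 2 \<Longrightarrow> 0 \<le> exit_rate d n"
  by (induction n) (auto intro!: add_nonneg_nonneg mult_nonneg_nonneg less_imp_le[OF up_prob_bounds(1)])

lemma exit_gf_le_exp:
  assumes "d \<ge> 2" "0 \<le> x" "x \<le> 1"
  shows "exit_gf d n x \<le> exp (- exit_rate d n * (1 - x))"
  using assms(2-)
proof (induction n arbitrary: x)
  case (Suc n)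
  have "exit_gf d (Suc n) x
      \<le> exit_step d x (exp (- exit_rate d n * (1 - x / 2))) (exp (- exit_rate d n * (1 - (1 + x) / 2)))"
    unfolding exit_gf.simps
    using assms(1) Suc.prems Suc.IH[of "x / 2"] Suc.IH[of "(1 + x) / 2"]
      exit_gf_bounds[of d "x / 2" "(1 + x) / 2" n] exit_rate_nonneg[of d n]
    by (intro exit_step_mono) (auto simp: mult_le_0_iff)
  also have "\<dots> \<le> exp (- exit_rate d (Suc n) * (1 - x))"
    unfolding exit_rate.simps using assms(1) Suc.prems exit_rate_nonneg by (intro exit_step_exp) auto
  finally show ?case .
qed simp

lemma exit_rate_unbounded:
  assumes "d \<ge> 2"
  shows "\<exists>n. B < exit_rate d n"
proof (rule ccontr)
  assume "\<not> ?thesis"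
  then have B: "exit_rate d n \<le> B" for n by (auto simp: not_less)
  define e where "e = up_prob d * exp (- B / 2) / 8"
  have e: "0 < e" using up_prob_bounds[OF assms] by (simp add: e_def)
  have "real n * e \<le> exit_rate d n" for n
  proof (induction n)
    case (Suc n)
    have "e \<le> up_prob d * exp (- exit_rate d n / 2) / 8"
      using B[of n] up_prob_bounds[OF assms] by (simp add: e_def)
    then show ?case using Suc by (simp add: algebra_simps)
  qed simp
  moreover obtain n where "B < real n * e" using reals_Archimedean3[OF e] by blast
  ultimately show False using B[of n] by (meson not_le order_trans)
qed

lemma exit_gf_vanishes:
  assumes "d \<ge> 2" "0 \<le> x" "x < 1" "0 < e"
  shows "\<exists>n. exit_gf d n x < e"
proof -
  obtain n where n: "- ln e / (1 - x) < exit_rate d n"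
    using exit_rate_unbounded[OF assms(1)] by blast
  then have "- exit_rate d n * (1 - x) < ln e"
    using assms by (simp add: field_simps)
  then have "exp (- exit_rate d n * (1 - x)) < e"
    using assms by (metis exp_less_cancel_iff exp_ln)
  then show ?thesis
    using exit_gf_le_exp[of d x n] assms by (meson le_less_trans less_imp_le)
qed

section \<open>Coupling with the frog model\<close>

text \<open>
  This removes the coins again: first inside one stream, then for the family of all frogs.
\<close>

lemma distr_PiM_componentwise:
  assumes M: "\<And>i. i \<in> I \<Longrightarrow> prob_space (M i)"
    and f [measurable]: "\<And>i. i \<in> I \<Longrightarrow> f i \<in> measurable (M i) (M' i)"
    and eq: "\<And>i. i \<in> I \<Longrightarrow> distr (M i) (M' i) (f i) = M' i"
  shows "distr (PiM I M) (PiM I M') (\<lambda>\<omega>. \<lambda>i\<in>I. f i (\<omega> i)) = PiM I M'"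
proof (rule measure_eqI_PiM_infinite)
  have M': "prob_space (M' i)" if "i \<in> I" for i
    using prob_space.prob_space_distr[OF M[OF that] f[OF that]] eq[OF that] by simp
  have meas [measurable]: "(\<lambda>\<omega>. \<lambda>i\<in>I. f i (\<omega> i)) \<in> measurable (PiM I M) (PiM I M')"
    by measurable
  interpret prob_space "PiM I M" by (rule prob_space_PiM[OF M])
  show "finite_measure (distr (PiM I M) (PiM I M') (\<lambda>\<omega>. \<lambda>i\<in>I. f i (\<omega> i)))"
    by (rule finite_measure_distr[OF meas])
  fix A J assume J: "finite J" "J \<subseteq> I" and A: "\<And>i. i \<in> J \<Longrightarrow> A i \<in> sets (M' i)"
  have "emeasure (distr (PiM I M) (PiM I M') (\<lambda>\<omega>. \<lambda>i\<in>I. f i (\<omega> i))) (prod_emb I M' J (Pi\<^sub>E J A)) =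
      emeasure (PiM I M) ((\<lambda>\<omega>. \<lambda>i\<in>I. f i (\<omega> i)) -` prod_emb I M' J (Pi\<^sub>E J A) \<inter> space (PiM I M))"
    using J A by (intro emeasure_distr meas sets_PiM_I) auto
  also have "(\<lambda>\<omega>. \<lambda>i\<in>I. f i (\<omega> i)) -` prod_emb I M' J (Pi\<^sub>E J A) \<inter> space (PiM I M) =
      prod_emb I M J (Pi\<^sub>E J (\<lambda>i. f i -` A i \<inter> space (M i)))"
    using J measurable_space[OF f]
    by (auto simp: prod_emb_def space_PiM PiE_iff subset_eq restrict_def extensional_def)
  also have "emeasure (PiM I M) \<dots> = (\<Prod>i\<in>J. emeasure (M i) (f i -` A i \<inter> space (M i)))"
    using J A by (intro emeasure_PiM_emb M measurable_sets[OF f]) auto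
  also have "\<dots> = (\<Prod>i\<in>J. emeasure (M' i) (A i))"
  proof (intro prod.cong refl)
    fix i assume "i \<in> J"
    then have "i \<in> I" using J by auto
    then show "emeasure (M i) (f i -` A i \<inter> space (M i)) = emeasure (M' i) (A i)"
      using emeasure_distr[OF f A] \<open>i \<in> J\<close> eq by metis
  qed
  also have "\<dots> = emeasure (PiM I M') (prod_emb I M' J (Pi\<^sub>E J A))"
    using J A by (intro emeasure_PiM_emb[symmetric] M') auto
  finally show "emeasure (distr (PiM I M) (PiM I M') (\<lambda>\<omega>. \<lambda>i\<in>I. f i (\<omega> i))) (prod_emb I M' J (Pi\<^sub>E J A)) =
      emeasure (PiM I M') (prod_emb I M' J (Pi\<^sub>E J A))" .
qed simp_all

lemma distr_stream_space_smap:
  assumes "prob_space M" and f [measurable]: "f \<in> measurable M M'" and eq: "distr M M' f = M'"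
  shows "distr (stream_space M) (stream_space M') (smap f) = stream_space M'"
proof -
  have smap: "smap f (to_stream X) = to_stream (\<lambda>i. f (X i))" for X :: "nat \<Rightarrow> _"
    by (simp add: to_stream_def) (simp add: smap_siterate stream.map_comp o_def)
  have "distr (stream_space M) (stream_space M') (smap f) =
      distr (\<Pi>\<^sub>M i\<in>UNIV. M) (stream_space M') (smap f \<circ> to_stream)"
    by (subst stream_space_eq_distr) (simp add: distr_distr)
  also have "\<dots> = distr (\<Pi>\<^sub>M i\<in>UNIV. M) (stream_space M') (to_stream \<circ> (\<lambda>X. \<lambda>i\<in>UNIV. f (X i)))"
    by (simp add: o_def smap restrict_def)
  also have "\<dots> = distr (distr (\<Pi>\<^sub>M i\<in>UNIV. M) (\<Pi>\<^sub>M i\<in>UNIV. M') (\<lambda>X. \<lambda>i\<in>UNIV. f (X i))) (stream_space M') to_stream"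
    by (subst distr_distr) simp_all
  also have "\<dots> = distr (\<Pi>\<^sub>M i\<in>UNIV. M') (stream_space M') to_stream"
    by (subst distr_PiM_componentwise) (use assms in auto)
  also have "\<dots> = stream_space M'" by (rule stream_space_eq_distr[symmetric])
  finally show ?thesis .
qed

text \<open>
  The frog of the root is never killed, so that it enters a child subtree of the root almost surely.
\<close>

definition coin_prob :: "nat \<Rightarrow> vertex \<Rightarrow> real" where
  "coin_prob d u = (if u = [] then 0 else kill_prob d)"

definition coin_space :: "nat \<Rightarrow> (vertex \<Rightarrow> coin_mark stream) measure" where
  "coin_space d = (\<Pi>\<^sub>M u \<in> vertices d. coin_streams d (coin_prob d u))"

definition forget_coins :: "nat \<Rightarrow> (vertex \<Rightarrow> coin_mark stream) \<Rightarrow> (vertex \<Rightarrow> mark stream)" where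
  "forget_coins d \<omega> = (\<lambda>u\<in>vertices d. smap snd (\<omega> u))"

lemma coin_prob_bounds: "d \<ge> 2 \<Longrightarrow> 0 \<le> coin_prob d u" "d \<ge> 2 \<Longrightarrow> coin_prob d u \<le> 1"
  using kill_prob_bounds by (auto simp: coin_prob_def)

lemma distr_smap_snd:
  "distr (coin_streams d k) (stream_space (measure_pmf (mark_pmf d (1/3)))) (smap snd) =
    stream_space (measure_pmf (mark_pmf d (1/3)))"
proof (rule distr_stream_space_smap)
  have "distr (coin_mark_pmf d k) (mark_pmf d (1/3)) snd = measure_pmf (map_pmf snd (coin_mark_pmf d k))"
    unfolding map_pmf_rep_eq by (rule distr_cong) auto
  also have "map_pmf snd (coin_mark_pmf d k) = mark_pmf d (1/3)"
    by (simp add: coin_mark_pmf_def map_snd_pair_pmf)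
  finally show "distr (coin_mark_pmf d k) (mark_pmf d (1/3)) snd = mark_pmf d (1/3)" .
qed (auto simp: prob_space_measure_pmf)

lemma measurable_smap_snd [measurable]:
  "smap snd \<in> measurable (coin_streams d k) (stream_space (measure_pmf (mark_pmf d (1/3))))"
  by (rule measurable_smap) simp

lemma measurable_forget_coins [measurable]:
  "forget_coins d \<in> measurable (coin_space d) (frog_space d (1/3))"
  unfolding forget_coins_def[abs_def] coin_space_def frog_space_def by measurable

lemma distr_forget_coins: "distr (coin_space d) (frog_space d (1/3)) (forget_coins d) = frog_space d (1/3)"
  unfolding coin_space_def frog_space_def forget_coins_def[abs_def]
  by (rule distr_PiM_componentwise) (auto intro: prob_space_coin_streams distr_smap_snd measurable_smap_snd)

lemma prob_space_coin_space: "prob_space (coin_space d)"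
  unfolding coin_space_def by (intro prob_space_PiM prob_space_coin_streams)

definition upper_levels :: "nat \<Rightarrow> nat \<Rightarrow> vertex set" where
  "upper_levels d N = {w \<in> vertices d. length w \<le> N}"

lemma finite_upper_levels [simp]: "finite (upper_levels d N)"
proof -
  have "upper_levels d N = {s. set s \<subseteq> {..<d} \<and> length s \<le> N}"
    by (auto simp: upper_levels_def vertices_def)
  then show ?thesis by (simp add: finite_lists_length_le)
qed

text \<open>
  Truncation at level \<open>N\<close> leaves finitely many possible rays, so that the rays of finitely many frogs
  have a discrete joint law.
\<close>

definition trunc_ends :: "nat \<Rightarrow> nat \<Rightarrow> vertex \<Rightarrow> coin_mark stream \<Rightarrow> vertex set" where
  "trunc_ends d N u s = ends u s \<inter> upper_levels d N"

lemma measurable_trunc_ends [measurable]: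
  "trunc_ends d N u \<in> measurable (coin_streams d k) (count_space UNIV)"
proof -
  have "trunc_ends d N u \<in> measurable (coin_streams d k) (count_space (Pow (upper_levels d N)))"
  proof (subst measurable_count_space_eq2)
    show "finite (Pow (upper_levels d N))" by simp
    show "trunc_ends d N u \<in> space (coin_streams d k) \<rightarrow> Pow (upper_levels d N) \<and>
      (\<forall>a\<in>Pow (upper_levels d N). trunc_ends d N u -` {a} \<inter> space (coin_streams d k) \<in> sets (coin_streams d k))"
    proof (intro conjI ballI)
      fix a assume a: "a \<in> Pow (upper_levels d N)"
      have "ends u s \<inter> upper_levels d N = a \<longleftrightarrow> (\<forall>w\<in>upper_levels d N. w \<in> ends u s \<longleftrightarrow> w \<in> a)" for s
        using a by blast
      then have "trunc_ends d N u -` {a} \<inter> space (coin_streams d k) =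
          {s \<in> space (coin_streams d k). \<forall>w\<in>upper_levels d N. w \<in> ends u s \<longleftrightarrow> w \<in> a}"
        unfolding trunc_ends_def by blast
      also have "\<dots> \<in> sets (coin_streams d k)"
      proof (rule sets.sets_Collect_finite_All)
        show "{s \<in> space (coin_streams d k). (w \<in> ends u s) = (w \<in> a)} \<in> sets (coin_streams d k)" for w
          using measurable_ends[where d = d and k = k and w = w and u = u]
          by (cases "w \<in> a") (simp_all add: pred_def sets.sets_Collect_neg)
      qed simp
      finally show "trunc_ends d N u -` {a} \<inter> space (coin_streams d k) \<in> sets (coin_streams d k)" .
    qed (auto simp: trunc_ends_def)
  qed
  from measurable_compose[OF this, of "\<lambda>e. e" "count_space UNIV"] show ?thesis by simp
qed

definition end_law :: "nat \<Rightarrow> nat \<Rightarrow> vertex \<Rightarrow> vertex set pmf" where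
  "end_law d N u = Abs_pmf (distr (coin_streams d (coin_prob d u)) (count_space UNIV) (trunc_ends d N u))"

lemma measure_end_law: "measure_pmf (end_law d N u) =
    distr (coin_streams d (coin_prob d u)) (count_space UNIV) (trunc_ends d N u)"
proof -
  define M where "M = distr (coin_streams d (coin_prob d u)) (count_space UNIV) (trunc_ends d N u)"
  interpret prob_space M unfolding M_def
    by (intro prob_space.prob_space_distr prob_space_coin_streams measurable_trunc_ends)
  have "AE e in M. measure M {e} \<noteq> 0"
  proof -
    define Z where "Z = {e \<in> Pow (upper_levels d N). measure M {e} = 0}"
    have "AE e in M. e \<in> Pow (upper_levels d N)"
      unfolding M_def by (subst AE_distr_iff) (auto simp: trunc_ends_def)
    moreover have "AE e in M. \<forall>z\<in>Z. e \<noteq> z"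
    proof (intro AE_finite_allI)
      show "finite Z" by (simp add: Z_def)
      fix z assume "z \<in> Z"
      then have "emeasure M {z} = 0" by (simp add: Z_def emeasure_eq_measure)
      then show "AE e in M. e \<noteq> z" by (intro AE_I[of _ _ "{z}"]) (auto simp: M_def)
    qed
    ultimately show ?thesis by eventually_elim (auto simp: Z_def)
  qed
  moreover have "sets M = UNIV" by (simp add: M_def)
  ultimately have "M \<in> {M. prob_space M \<and> sets M = UNIV \<and> (AE x in M. measure M {x} \<noteq> 0)}"
    using prob_space_axioms by blast
  then show ?thesis unfolding end_law_def M_def[symmetric] by (rule Abs_pmf_inverse)
qed

lemma prob_end_law:
  "measure (end_law d N u) {e. P e} =
    measure (coin_streams d (coin_prob d u)) {s \<in> space (coin_streams d (coin_prob d u)). P (trunc_ends d N u s)}"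
  unfolding measure_end_law by (subst measure_distr) (auto intro!: arg_cong[where f = "measure _"])

definition regular :: "nat \<Rightarrow> vertex \<Rightarrow> coin_mark stream \<Rightarrow> bool" where
  "regular d u s \<longleftrightarrow> escaping d u s \<and> (u = [] \<longrightarrow> (\<forall>n. \<not> fst (s !! n)))"

lemma AE_regular:
  assumes "d \<ge> 2"
  shows "AE s in coin_streams d (coin_prob d u). regular d u s"
proof -
  have "AE s in coin_streams d (coin_prob d u). u = [] \<longrightarrow> stream_all (\<lambda>m. \<not> fst m) s"
  proof (cases "u = []")
    case True
    have "True \<notin> set_pmf (bernoulli_pmf 0)" by (simp add: set_pmf_iff)
    then have "AE s in coin_streams d (coin_prob d u). stream_all (\<lambda>m. \<not> fst m) s"
      using True by (intro prob_space.AE_stream_all[OF prob_space_measure_pmf])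
        (auto simp: AE_measure_pmf_iff coin_mark_pmf_def coin_prob_def)
    then show ?thesis by eventually_elim simp
  qed simp
  with AE_escaping[OF assms coin_prob_bounds[OF assms], of u u] show ?thesis
    by eventually_elim (simp add: regular_def stream_all_def)
qed

text \<open>
  Almost sure properties of the ray hold for every truncated ray of positive probability.
\<close>

lemma set_end_law:
  assumes "d \<ge> 2" "e \<in> set_pmf (end_law d N u)"
  shows "\<exists>s. regular d u s \<and> e = trunc_ends d N u s"
proof (rule ccontr)
  assume none: "\<not> ?thesis"
  interpret prob_space "coin_streams d (coin_prob d u)" by (rule prob_space_coin_streams)
  have "AE s in coin_streams d (coin_prob d u). \<not> trunc_ends d N u s = e"
    using AE_regular[OF assms(1), of u] by eventually_elim (use none in auto)
  then have "prob {s \<in> space (coin_streams d (coin_prob d u)). trunc_ends d N u s = e} = 0"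
    by (subst prob_eq_0) auto
  then have "measure (end_law d N u) {e'. e' = e} = 0" unfolding prob_end_law .
  then have "pmf (end_law d N u) e = 0" by (simp add: pmf.rep_eq)
  then show False using assms(2) by (simp add: set_pmf_iff)
qed

lemma trunc_ends_descend:
  assumes "regular d u s" "u \<in> vertices d" "w \<in> trunc_ends d N u s" "length w < N"
  shows "\<exists>i<d. i # w \<in> trunc_ends d N u s"
  using ends_descend[of d u s w] assms
  by (auto simp: regular_def trunc_ends_def upper_levels_def vertices_def)

lemma end_laws_end_law:
  assumes d: "d \<ge> 2"
  shows "end_laws d N (end_law d N)"
proof
  show "finite (set_pmf (end_law d N u))" for u
    by (rule finite_subset[of _ "Pow (upper_levels d N)"]) (auto dest!: set_end_law[OF d] simp: trunc_ends_def)
next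
  fix u e i w assume "e \<in> set_pmf (end_law d N u)" "i # w \<in> e"
  then show "w \<in> e"
    using ends_mono[of "i # w" u _ w] by (auto dest!: set_end_law[OF d] simp: trunc_ends_def upper_levels_def vertices_def suffix_Cons)
next
  fix u e w assume "u \<in> vertices d" "e \<in> set_pmf (end_law d N u)" "w \<in> e" "length w < N"
  then show "\<exists>i<d. i # w \<in> e"
    using trunc_ends_descend by (blast dest!: set_end_law[OF d])
next
  fix u e i j w assume "e \<in> set_pmf (end_law d N u)" "i # w \<in> e" "j # w \<in> e"
  then show "i = j"
    using ends_unique by (auto dest!: set_end_law[OF d] simp: trunc_ends_def)
next
  fix u w assume u: "u \<in> vertices d" "u \<noteq> []" and w: "suffix w u" "length w \<le> N"
  interpret prob_space "coin_streams d (kill_prob d)" by (rule prob_space_coin_streams)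
  have "w \<in> vertices d" using u w by (auto simp: vertices_def suffix_def)
  then have w': "w \<in> upper_levels d N" using w by (simp add: upper_levels_def)
  have "measure (end_law d N u) {e. w \<notin> e} =
      prob {s \<in> space (coin_streams d (kill_prob d)). \<not> w \<in> ends u s}"
    unfolding prob_end_law using u w' by (simp add: coin_prob_def trunc_ends_def)
  also have "\<dots> = 1 - prob {s \<in> space (coin_streams d (kill_prob d)). w \<in> ends u s}"
    by (rule prob_neg) measurable
  also have "\<dots> = up_prob d * (1 / 2) ^ (length u - length w)"
    unfolding prob_ends[OF d \<open>w \<in> vertices d\<close>] using w by (simp add: end_prob_simps)
  finally show "measure (end_law d N u) {e. w \<notin> e} = up_prob d * (1 / 2) ^ (length u - length w)" .
next
  fix u i assume u: "u \<in> vertices d" "u \<noteq> []" and i: "i < d" "length u < N"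
  have v: "i # u \<in> vertices d" using u i by (auto simp: vertices_def)
  then have v': "i # u \<in> upper_levels d N" using i by (simp add: upper_levels_def)
  have "\<not> suffix (i # u) u" by (auto dest: suffix_length_le)
  moreover have "suffix u (i # u)" by (simp add: suffix_Cons)
  ultimately have "end_prob d (i # u) (Some u) = (1 - up_prob d) / real d"
    using outside_prob_ancestor[of u "i # u" d] by (simp add: end_prob_simps)
  moreover have "measure (end_law d N u) {e. i # u \<in> e} =
      measure (coin_streams d (kill_prob d)) {s \<in> space (coin_streams d (kill_prob d)). i # u \<in> ends u s}"
    unfolding prob_end_law using u v' by (simp add: coin_prob_def trunc_ends_def)
  ultimately show "measure (end_law d N u) {e. i # u \<in> e} = (1 - up_prob d) / real d"
    unfolding prob_ends[OF d v] by simp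
qed (use d in auto)

definition all_ends :: "nat \<Rightarrow> nat \<Rightarrow> vertex set \<Rightarrow> (vertex \<Rightarrow> coin_mark stream) \<Rightarrow> vertex \<Rightarrow> vertex set" where
  "all_ends d N F \<omega> u = (if u \<in> F then trunc_ends d N u (\<omega> u) else {})"

lemma measurable_all_ends_event:
  assumes "finite F" "F \<subseteq> vertices d"
  shows "{\<omega> \<in> space (coin_space d). all_ends d N F \<omega> = g} \<in> sets (coin_space d)"
proof -
  have [measurable]: "(\<lambda>\<omega>. trunc_ends d N u (\<omega> u)) \<in> measurable (coin_space d) (count_space UNIV)" if "u \<in> F" for u
    unfolding coin_space_def 
    by (rule measurable_compose[where g = "trunc_ends d N u", OF _ measurable_trunc_ends],
        rule measurable_component_singleton) (use assms that in auto)
  have "{\<omega> \<in> space (coin_space d). all_ends d N F \<omega> = g} =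
      {\<omega> \<in> space (coin_space d). (\<forall>u\<in>F. trunc_ends d N u (\<omega> u) = g u) \<and> (\<forall>u. u \<notin> F \<longrightarrow> g u = {})}"
    by (auto simp: all_ends_def fun_eq_iff)
  also have "\<dots> \<in> sets (coin_space d)" using assms by measurable
  finally show ?thesis .
qed

text \<open>
  The frogs have independent streams, hence independent truncated rays.
\<close>

lemma prob_all_ends_eq:
  assumes F: "finite F" "F \<subseteq> vertices d"
  shows "measure (coin_space d) {\<omega> \<in> space (coin_space d). all_ends d N F \<omega> = g} =
    pmf (Pi_pmf F {} (end_law d N)) g"
proof (cases "\<forall>u. u \<notin> F \<longrightarrow> g u = {}")
  case True
  define M where "M u = coin_streams d (coin_prob d u)" for u
  have "all_ends d N F \<omega> = g \<longleftrightarrow> (\<forall>u\<in>F. trunc_ends d N u (\<omega> u) = g u)" for \<omega>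
    using True by (auto simp: all_ends_def fun_eq_iff)
  moreover have "space (M u) = UNIV" for u by (simp add: M_def space_stream_space streams_UNIV)
  ultimately have "{\<omega> \<in> space (coin_space d). all_ends d N F \<omega> = g} =
      prod_emb (vertices d) M F (\<Pi>\<^sub>E u\<in>F. {s \<in> space (M u). trunc_ends d N u s = g u})"
    by (auto simp: prod_emb_def coin_space_def M_def[symmetric] space_PiM Pi_iff)
  then have "emeasure (coin_space d) {\<omega> \<in> space (coin_space d). all_ends d N F \<omega> = g} =
      (\<Prod>u\<in>F. emeasure (M u) {s \<in> space (M u). trunc_ends d N u s = g u})"
    unfolding coin_space_def M_def[symmetric] using F
    by (simp, intro emeasure_PiM_emb) (auto simp: M_def intro: prob_space_coin_streams)
  also have "\<dots> = (\<Prod>u\<in>F. ennreal (pmf (end_law d N u) (g u)))"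
  proof (intro prod.cong refl)
    fix u
    interpret prob_space "M u" unfolding M_def by (rule prob_space_coin_streams)
    have "pmf (end_law d N u) (g u) = measure (end_law d N u) {e. e = g u}" by (simp add: pmf.rep_eq)
    also have "\<dots> = prob {s \<in> space (M u). trunc_ends d N u s = g u}"
      unfolding prob_end_law M_def ..
    finally show "emeasure (M u) {s \<in> space (M u). trunc_ends d N u s = g u} = ennreal (pmf (end_law d N u) (g u))"
      by (simp add: emeasure_eq_measure)
  qed
  also have "\<dots> = ennreal (pmf (Pi_pmf F {} (end_law d N)) g)"
    using True F by (subst pmf_Pi') (auto simp: prod_ennreal)
  finally show ?thesis by (simp add: measure_def)
next
  case False
  then have empty: "{\<omega> \<in> space (coin_space d). all_ends d N F \<omega> = g} = {}"
    by (auto simp: all_ends_def)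
  show ?thesis unfolding empty using False F by (simp add: pmf_Pi_outside)
qed

lemma prob_all_ends:
  assumes F: "finite F" "F \<subseteq> vertices d"
  shows "{\<omega> \<in> space (coin_space d). all_ends d N F \<omega> \<in> X} \<in> sets (coin_space d)"
    and "measure (coin_space d) {\<omega> \<in> space (coin_space d). all_ends d N F \<omega> \<in> X} =
      measure (Pi_pmf F {} (end_law d N)) X"
proof -
  interpret prob_space "coin_space d" by (rule prob_space_coin_space)
  define K where "K = PiE_dflt F {} (\<lambda>_. Pow (upper_levels d N))"
  have K: "finite K" unfolding K_def using F by (intro finite_PiE_dflt) auto
  have in_K: "all_ends d N F \<omega> \<in> K" for \<omega>
    by (auto simp: all_ends_def K_def PiE_dflt_def trunc_ends_def)
  define S where "S g = {\<omega> \<in> space (coin_space d). all_ends d N F \<omega> = g}" for g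
  have S: "S g \<in> sets (coin_space d)" for g unfolding S_def by (rule measurable_all_ends_event[OF F])
  have eq: "{\<omega> \<in> space (coin_space d). all_ends d N F \<omega> \<in> X} = (\<Union>g\<in>X \<inter> K. S g)"
    using in_K by (auto simp: S_def)
  show "{\<omega> \<in> space (coin_space d). all_ends d N F \<omega> \<in> X} \<in> sets (coin_space d)"
    unfolding eq using K S by auto
  have mass: "measure (coin_space d) {\<omega> \<in> space (coin_space d). all_ends d N F \<omega> \<in> Y} =
      sum (pmf (Pi_pmf F {} (end_law d N))) (Y \<inter> K)" for Y
  proof -
    have "{\<omega> \<in> space (coin_space d). all_ends d N F \<omega> \<in> Y} = (\<Union>g\<in>Y \<inter> K. S g)"
      using in_K by (auto simp: S_def)
    also have "prob \<dots> = (\<Sum>g\<in>Y \<inter> K. prob (S g))"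
      using K S by (intro finite_measure_finite_Union) (auto simp: disjoint_family_on_def S_def)
    finally show ?thesis unfolding S_def prob_all_ends_eq[OF F] .
  qed
  have "measure (Pi_pmf F {} (end_law d N)) K = 1"
    using mass[of UNIV] prob_space K by (simp add: measure_measure_pmf_finite)
  then have "AE g in Pi_pmf F {} (end_law d N). g \<in> K"
    by (subst measure_pmf.AE_in_set_eq_1) simp_all
  then have "measure (Pi_pmf F {} (end_law d N)) X = measure (Pi_pmf F {} (end_law d N)) (X \<inter> K)"
    by (intro measure_pmf.finite_measure_eq_AE) auto
  also have "\<dots> = sum (pmf (Pi_pmf F {} (end_law d N))) (X \<inter> K)"
    using K by (intro measure_measure_pmf_finite) auto
  finally show "measure (coin_space d) {\<omega> \<in> space (coin_space d). all_ends d N F \<omega> \<in> X} =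
      measure (Pi_pmf F {} (end_law d N)) X"
    using mass[of X] by simp
qed

section \<open>Recurrence at drift one third\<close>

text \<open>
  The frog of the root enters the subtree of a child of the root along its own ray. Frogs that leave
  this subtree visit the root.
\<close>

definition root_exits :: "nat \<Rightarrow> nat \<Rightarrow> (vertex \<Rightarrow> vertex set) \<Rightarrow> vertex set" where
  "root_exits d n \<delta> = exits d n [child d {} [] (\<delta> [])] (\<delta> []) \<delta>"

text \<open>
  The ray of the frog of the root is independent of all other rays, and the generating function of
  the exits is the same for every entering ray.
\<close>

lemma (in end_laws) expectation_root_exits:
  assumes "N = Suc n"
  shows "measure_pmf.expectation (Pi_pmf (subtree d N []) {} q) (\<lambda>\<delta>. x ^ card (root_exits d n \<delta>)) = exit_gf d n x"
proof -
  define F where "F = subtree d N [] - {[]}"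
  have finF: "finite F" by (simp add: F_def)
  have split: "subtree d N [] = {[]} \<union> F" using subtree_self[of "[]" d n] assms by (auto simp: F_def)
  have "measure_pmf.expectation (Pi_pmf F {} q) (\<lambda>g. x ^ card (root_exits d n (\<lambda>u. if u \<in> {[]} then f u else g u)))
      = exit_gf d n x" for f
  proof -
    define c where "c = child d {} [] (f [])"
    have c: "c < d" unfolding c_def using d2 by (intro child_less) auto
    have sub: "subtree d n [c] \<subseteq> F"
      using subtree_child[OF c, of n "[]"] subtree_child_not_self[of "[]" d n c] assms by (auto simp: F_def)
    have "root_exits d n (\<lambda>u. if u \<in> {[]} then f u else g u) = exits d n [c] (f []) g" for g
    proof -
      have "(if u \<in> {[]} then f u else g u) = g u" if "u \<in> subtree d n [c]" for u
        using that sub by (auto simp: F_def)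
      then have "exits d n [c] (f []) (\<lambda>u. if u \<in> {[]} then f u else g u) = exits d n [c] (f []) g"
        using d2 by (intro exits_cong) auto
      then show ?thesis by (simp add: root_exits_def c_def)
    qed
    then have "measure_pmf.expectation (Pi_pmf F {} q) (\<lambda>g. x ^ card (root_exits d n (\<lambda>u. if u \<in> {[]} then f u else g u)))
        = measure_pmf.expectation (Pi_pmf F {} q) (\<lambda>g. \<Prod>u\<in>exits d n [c] (f []) g. x)"
      by simp
    also have "\<dots> = exit_gf d n x"
    proof (rule expectation_exits)
      show "[c] \<in> vertices d" using c by (simp add: vertices_def)
      fix u assume u: "u \<in> subtree d n [c]"
      then have "u \<noteq> []" "u \<in> vertices d"
        using subtree_length[OF u] subtree_vertices[OF \<open>[c] \<in> vertices d\<close> u] by auto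
      then show "measure_pmf.expectation (q u) (\<lambda>e. x * of_bool ([c] \<notin> e)) = x * (up_prob d * (1 / 2) ^ (length u - length [c]))"
        using exit_prob[of u "[c]"] subtree_suffix[OF u] assms by (simp add: expectation_q_of_bool)
    qed (use assms finF sub in auto)
    finally show ?thesis .
  qed
  then show ?thesis
    unfolding split using finF finite_q by (subst expectation_Pi_pmf_Un) (auto simp: F_def)
qed

lemma (in end_laws) prob_few_root_exits:
  assumes "N = Suc n" "0 < x" "x \<le> 1"
  shows "measure (Pi_pmf (subtree d N []) {} q) {\<delta>. card (root_exits d n \<delta>) \<le> k} \<le> exit_gf d n x / x ^ k"
proof -
  define P where "P = Pi_pmf (subtree d N []) {} q"
  have int: "integrable (measure_pmf P) G" for G :: "_ \<Rightarrow> real"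
    unfolding P_def by (intro integrable_measure_pmf_finite finite_set_Pi_pmf finite_q) simp
  have "x ^ k * measure P {\<delta>. card (root_exits d n \<delta>) \<le> k} =
      measure_pmf.expectation P (\<lambda>\<delta>. x ^ k * indicator {\<delta>. card (root_exits d n \<delta>) \<le> k} \<delta>)"
    by simp
  also have "\<dots> \<le> measure_pmf.expectation P (\<lambda>\<delta>. x ^ card (root_exits d n \<delta>))"
    using assms by (intro integral_mono int) (auto simp: indicator_def intro: power_decreasing)
  also have "\<dots> = exit_gf d n x" unfolding P_def by (rule expectation_root_exits[OF assms(1)])
  finally show ?thesis using assms(2) unfolding P_def by (simp add: field_simps)
qed

text \<open>
  The exploration follows visits that take place in the frog model: every vertex on a ray is
  visited by its frog, and every exit is an activated frog that leaves through the root.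
\<close>

lemma root_exits_le_visits:
  assumes d: "d \<ge> 2" and N: "N = Suc n"
    and reg: "\<And>u. u \<in> subtree d N [] \<Longrightarrow> regular d u (\<omega> u)"
  shows "of_nat (card (root_exits d n (all_ends d N (subtree d N []) \<omega>))) \<le> root_visits d (forget_coins d \<omega>)"
proof -
  define F \<delta> \<eta> where "F = subtree d N []" and "\<delta> = all_ends d N F \<omega>" and "\<eta> = forget_coins d \<omega>"
  have F: "u \<in> F \<longleftrightarrow> u \<in> vertices d \<and> length u < N" for u by (auto simp: F_def subtree_def)
  have visit: "walk u (\<eta> u) m = y" if "u \<in> vertices d" "kwalk (Some u) (\<omega> u) m = Some y" for u m y
    using walk_eq_kwalk[OF that(2)] that(1) by (simp add: \<eta>_def forget_coins_def)
  have aw: "y \<in> awake d \<eta>" if "u \<in> awake d \<eta>" "u \<in> vertices d" "y \<in> vertices d" "kwalk (Some u) (\<omega> u) m = Some y" for u m y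
    using awake_visits[OF that(1), of m] visit[OF that(2,4)] that(3) by simp
  have awv: "u \<in> vertices d" if "u \<in> awake d \<eta>" for u
    using that age_in_vertices by (auto simp: awake_def)
  have \<delta>: "\<delta> u = trunc_ends d N u (\<omega> u)" "regular d u (\<omega> u)" if "u \<in> vertices d" "length u < N" for u
    using that reg[of u] by (auto simp: \<delta>_def all_ends_def F F_def[symmetric])
  have desc: "\<exists>i<d. i # w \<in> \<delta> u" if "u \<in> vertices d" "length u < N" "w \<in> \<delta> u" "length w < N" for u w
    using trunc_ends_descend[of d u "\<omega> u" w N] that \<delta>[OF that(1,2)] by simp
  have visits: "w \<in> awake d \<eta>" if "u \<in> awake d \<eta>" "length u < N" "w \<in> \<delta> u" "\<not> suffix w u" for u w
  proof -
    have "w \<in> ends u (\<omega> u)" "w \<in> vertices d"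
      using that(3) \<delta>[OF awv[OF that(1)] that(2)] by (auto simp: trunc_ends_def upper_levels_def)
    then show ?thesis using visits_of_ends[of w u "\<omega> u"] that(4) aw[OF that(1) awv[OF that(1)]] by blast
  qed
  have root: "[] \<in> vertices d" "[] \<in> awake d \<eta>" by (auto simp: vertices_def root_awake)
  have "\<forall>m. \<not> fst (\<omega> [] !! m)" using \<delta>(2)[of "[]"] root N by (simp add: regular_def)
  then have "[] \<in> \<delta> []"
    using \<delta>(1)[of "[]"] root N root_in_ends[of "\<omega> []" "[]"] by (simp add: trunc_ends_def upper_levels_def)
  then have "crosses d {} [] (\<delta> [])" using desc[of "[]" "[]"] root N by (auto simp: crosses_def)
  note c = child_props[OF this]
  define c where "c = child d {} [] (\<delta> [])"
  have c: "c < d" "[c] \<in> \<delta> []" using c by (auto simp: c_def)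
  have nonroot: "w \<in> awake d \<eta>" if "w \<in> \<delta> []" "suffix [c] w" for w
  proof -
    have "w \<noteq> []" using that(2) by auto
    then show ?thesis using visits[OF root(2) _ that(1)] N by auto
  qed
  have sub: "root_exits d n \<delta> \<subseteq> awake d \<eta>"
    unfolding root_exits_def c_def[symmetric]
  proof (rule exits_awake[where N = N])
    show "\<exists>i<d. i # w \<in> \<delta> u" if "u \<in> awake d \<eta>" "length u < N" "w \<in> \<delta> u" "length w < N" for u w
      using desc[OF awv[OF that(1)] that(2-4)] .
    show "\<exists>i<d. i # w \<in> \<delta> []" if "w \<in> \<delta> []" "length w < N" for w
      using desc[OF root(1) _ that] N by simp
    show "[c] \<in> awake d \<eta>" using nonroot[OF c(2)] by simp
  qed (use d N c visits nonroot in auto)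
  have "\<exists>m. walk u (\<eta> u) m = []" if u: "u \<in> root_exits d n \<delta>" for u
  proof -
    have st: "u \<in> subtree d n [c]"
      using u exits_subset[of d n "[c]"] d unfolding root_exits_def c_def[symmetric] by auto
    have "[c] \<in> vertices d" using c by (simp add: vertices_def)
    then have uv: "u \<in> vertices d" "length u < N" using subtree_vertices st subtree_length[OF st] N by auto
    have "[c] \<notin> \<delta> u" using u exits_leave unfolding root_exits_def c_def[symmetric] by blast
    then have "[c] \<notin> ends u (\<omega> u)"
      using \<delta>(1)[OF uv] \<open>[c] \<in> vertices d\<close> N by (auto simp: trunc_ends_def upper_levels_def)
    then obtain m where "kwalk (Some u) (\<omega> u) m = Some []"
      using visits_parent_of_not_ends[of "[c]" u "\<omega> u"] subtree_suffix[OF st] by auto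
    then show ?thesis using visit[OF uv(1)] by blast
  qed
  moreover have "finite (root_exits d n \<delta>)"
    unfolding root_exits_def by (rule finite_subset[OF exits_subset finite_subtree]) (use d in simp)
  ultimately show ?thesis
    using card_le_root_visits[OF _ sub] unfolding \<delta>_def F_def \<eta>_def by blast
qed

lemma prob_few_visits:
  assumes d: "d \<ge> 2" and x: "0 < x" "x \<le> 1"
  shows "measure (frog_space d (1/3)) {\<omega> \<in> space (frog_space d (1/3)). root_visits d \<omega> \<le> of_nat k}
    \<le> exit_gf d n x / x ^ k"
proof -
  define N where "N = Suc n"
  define F where "F = subtree d N []"
  interpret prob_space "coin_space d" by (rule prob_space_coin_space)
  interpret L: end_laws d N "end_law d N" by (rule end_laws_end_law[OF d])
  note measurable_root_visits[measurable]
  have F: "finite F" "F \<subseteq> vertices d"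
    using subtree_vertices[of "[]" d] by (auto simp: F_def vertices_def)
  have "AE \<omega> in coin_space d. \<forall>u\<in>F. regular d u (\<omega> u)"
    using F unfolding coin_space_def
    by (intro AE_finite_allI AE_PiM_component prob_space_coin_streams AE_regular d) auto
  then have le: "AE \<omega> in coin_space d. of_nat (card (root_exits d n (all_ends d N F \<omega>))) \<le> root_visits d (forget_coins d \<omega>)"
    by eventually_elim (use root_exits_le_visits[OF d N_def] in \<open>auto simp: F_def\<close>)
  have "measure (frog_space d (1/3)) {\<omega> \<in> space (frog_space d (1/3)). root_visits d \<omega> \<le> of_nat k} =
      measure (distr (coin_space d) (frog_space d (1/3)) (forget_coins d))
        {\<omega> \<in> space (frog_space d (1/3)). root_visits d \<omega> \<le> of_nat k}"
    by (simp add: distr_forget_coins)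
  also have "\<dots> = prob (forget_coins d -` {\<omega> \<in> space (frog_space d (1/3)). root_visits d \<omega> \<le> of_nat k} \<inter> space (coin_space d))"
    by (rule measure_distr) measurable
  also have "\<dots> \<le> prob {\<omega> \<in> space (coin_space d). all_ends d N F \<omega> \<in> {\<delta>. card (root_exits d n \<delta>) \<le> k}}"
  proof (rule finite_measure_mono_AE)
    show "AE \<omega> in coin_space d. \<omega> \<in> forget_coins d -` {\<omega> \<in> space (frog_space d (1/3)). root_visits d \<omega> \<le> of_nat k} \<inter> space (coin_space d)
      \<longrightarrow> \<omega> \<in> {\<omega> \<in> space (coin_space d). all_ends d N F \<omega> \<in> {\<delta>. card (root_exits d n \<delta>) \<le> k}}"
      using le
    proof eventually_elim
      case (elim \<omega>)
      have "card (root_exits d n (all_ends d N F \<omega>)) \<le> k" if "root_visits d (forget_coins d \<omega>) \<le> of_nat k"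
        using order_trans[OF elim that] by (simp only: of_nat_le_iff)
      then show ?case by auto
    qed
  qed (rule prob_all_ends(1)[OF F])
  also have "\<dots> = measure (Pi_pmf F {} (end_law d N)) {\<delta>. card (root_exits d n \<delta>) \<le> k}"
    by (rule prob_all_ends(2)[OF F])
  also have "\<dots> \<le> exit_gf d n x / x ^ k"
    unfolding F_def by (rule L.prob_few_root_exits[OF N_def x])
  finally show ?thesis .
qed

lemma recurrent_one_third:
  assumes d: "d \<ge> 2"
  shows "recurrent d (1 / 3)"
proof -
  define M where "M = frog_space d (1/3)"
  interpret prob_space M unfolding M_def frog_space_def
    by (intro prob_space_PiM prob_space.prob_space_stream_space prob_space_measure_pmf)
  have [measurable]: "root_visits d \<in> borel_measurable M" unfolding M_def by (rule measurable_root_visits)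
  have zero: "prob {\<omega> \<in> space M. root_visits d \<omega> \<le> of_nat k} = 0" for k
  proof (rule ccontr)
    assume "\<not> ?thesis"
    then have pos: "0 < prob {\<omega> \<in> space M. root_visits d \<omega> \<le> of_nat k}"
      using measure_nonneg[of M] by (simp add: less_le)
    then obtain n where "exit_gf d n (1/2) < prob {\<omega> \<in> space M. root_visits d \<omega> \<le> of_nat k} * (1/2) ^ k"
      using exit_gf_vanishes[OF d, of "1/2" "prob {\<omega> \<in> space M. root_visits d \<omega> \<le> of_nat k} * (1/2) ^ k"] by auto
    then show False
      using prob_few_visits[OF d, of "1/2" k n] unfolding M_def by (simp add: field_simps)
  qed
  have "AE \<omega> in M. \<forall>k::nat. \<not> root_visits d \<omega> \<le> of_nat k"
    unfolding AE_all_countable using zero by (intro allI prob_Collect_eq_0[THEN iffD1]) auto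
  then have "AE \<omega> in M. root_visits d \<omega> = \<infinity>"
  proof eventually_elim
    case (elim \<omega>)
    show ?case
    proof (rule ccontr)
      assume "\<not> ?case"
      then obtain k :: nat where "root_visits d \<omega> < of_nat k"
        using ennreal_Ex_less_of_nat[of "root_visits d \<omega>"] by (auto simp: less_top)
      then show False using elim by (meson less_imp_le)
    qed
  qed
  then have "prob {\<omega> \<in> space M. root_visits d \<omega> = \<infinity>} = 1"
    by (subst prob_Collect_eq_1) auto
  then show ?thesis by (simp add: recurrent_def M_def)
qed

theorem theorem1p2:
  fixes d :: nat
  assumes "d \<ge> 2"
  shows "critical_drift d \<le> 1 / 3"
  unfolding critical_drift_def using recurrent_one_third[OF assms]
  by (intro cInf_lower) auto

end
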